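(* Let $\Omega\subset\mathbb{R}^n$ be open and let $p:\Omega\to[1,\infty)$ be measurable with $p^+=\operatorname{ess\,sup}_{\Omega}p<\infty$. Then the mixed capacity $C_{\widetilde{\mathrm{BV}}^{p(\cdot)}}$ is a Choquet capacity on $\Omega$, and for every Borel set $E\subset\Omega$ $$C_{\widetilde{\mathrm{BV}}^{p(\cdot)}}(E)=\sup\{C_{\widetilde{\mathrm{BV}}^{p(\cdot)}}(K):K\subset E,\ K\text{ compact}\}=\inf\{C_{\widetilde{\mathrm{BV}}^{p(\cdot)}}(U):E\subset U\subset\Omega,\ U\text{ open}\}.$$
   Context: $L^{p(\cdot)}(\Omega)$ is the variable exponent Lebesgue space of measurable $u:\Omega\to\mathbb{R}$ (identified when equal a.e.) with $\int_\Omega |u/\lambda|^{p(x)}dx<\infty$ for some $\lambda>0$, with Luxemburg norm $\|u\|_{p(\cdot)}=\inf\{\lambda>0:\int_\Omega|u/\lambda|^{p(x)}dx\le 1\}$; $\varrho_{p(\cdot)}(u)=\int_\Omega|u(x)|^{p(x)}dx$. $\mathrm{Lip}_{\mathrm{loc}}(\Omega)$ denotes the locally Lipschitz functions on $\Omega$. For $u\in L^{p(\cdot)}(\Omega)$ define $$\varrho_{\widetilde{\mathrm{BV}}^{p(\cdot)}}(u)=\inf\Big\{\liminf_{i\to\infty}\int_\Omega|\nabla u_i(x)|^{p(x)}dx\Big\},$$ the infimum being over all sequences $(u_i)$ in $\mathrm{Lip}_{\mathrm{loc}}(\Omega)\cap L^{p(\cdot)}(\Omega)$ with $u_i\to u$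 in $L^{p(\cdot)}(\Omega)$, and $\widetilde{\mathrm{BV}}^{p(\cdot)}(\Omega)=\{u\in L^{p(\cdot)}(\Omega):\varrho_{\widetilde{\mathrm{BV}}^{p(\cdot)}}(u)<\infty\}$. For $E\subset\Omega$ let $\mathcal{A}_{\widetilde{\mathrm{BV}}^{p(\cdot)}}(E)$ be the set of $u\in\widetilde{\mathrm{BV}}^{p(\cdot)}(\Omega)$ with $0\le u\le1$ and $u=1$ in an open neighbourhood of $E$. The mixed capacity of $E\subset\Omega$ is $$C_{\widetilde{\mathrm{BV}}^{p(\cdot)}}(E)=\inf\{\varrho_{p(\cdot)}(u)+\varrho_{\widetilde{\mathrm{BV}}^{p(\cdot)}}(u):u\in\mathcal{A}_{\widetilde{\mathrm{BV}}^{p(\cdot)}}(E)\},$$ with $\inf\varnothing=\infty$. A set function $c$ defined on all subsets of $\Omega$ with values in $[0,\infty]$ is a Choquet capacity if it is monotone with respect to inclusion, $c(\bigcup_i E_i)=\lim_i c(E_i)$ for every increasing sequence of subsets $E_1\subset E_2\subset\dots\subset\Omega$, and $c(\bigcap_i K_i)=\lim_i c(K_i)$ for every decreasing sequence $K_1\supset K_2\supset\dots$ of compact subsets of $\Omega$. *)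

theory Defs
  imports "HOL-Analysis.Analysis" "HOL-Probability.Essential_Supremum"
begin

text \<open>
  Functions on \<open>\<Omega>\<close> are total functions whose values outside \<open>\<Omega>\<close> are irrelevant.  Elements of
  \<open>L\<^sup>p\<^sup>(\<^sup>\<cdot>\<^sup>)(\<Omega>)\<close> are represented by functions rather than by classes modulo a.e. equality; conditions
  on such elements are accordingly imposed almost everywhere.
\<close>

definition modular :: "(real^'n) set \<Rightarrow> (real^'n \<Rightarrow> real) \<Rightarrow> (real^'n \<Rightarrow> real) \<Rightarrow> ennreal" where
  "modular \<Omega> p u = (\<integral>\<^sup>+ x. ennreal (\<bar>u x\<bar> powr p x) \<partial>lebesgue_on \<Omega>)"

definition Lp_var :: "(real^'n) set \<Rightarrow> (real^'n \<Rightarrow> real) \<Rightarrow> (real^'n \<Rightarrow> real) set" where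
  "Lp_var \<Omega> p = {u \<in> borel_measurable (lebesgue_on \<Omega>).
     \<exists>l>0. modular \<Omega> p (\<lambda>x. u x / l) < \<infinity>}"

text \<open>For \<open>1 \<le> p\<close> the infimum below is over a nonempty set whenever \<open>u\<close> belongs to \<open>Lp_var \<Omega> p\<close>.\<close>

definition luxemburg_norm :: "(real^'n) set \<Rightarrow> (real^'n \<Rightarrow> real) \<Rightarrow> (real^'n \<Rightarrow> real) \<Rightarrow> real" where
  "luxemburg_norm \<Omega> p u = Inf {l. 0 < l \<and> modular \<Omega> p (\<lambda>x. u x / l) \<le> 1}"

definition Lip_loc :: "(real^'n) set \<Rightarrow> (real^'n \<Rightarrow> real) set" where
  "Lip_loc \<Omega> = {u. \<forall>x\<in>\<Omega>. \<exists>r>0. \<exists>L. L-lipschitz_on (ball x r \<inter> \<Omega>) u}"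

text \<open>
  By Rademacher's theorem a locally Lipschitz function on an open set is differentiable almost
  everywhere, so the value chosen at points of non-differentiability does not affect integrals.
\<close>

definition grad :: "(real^'n \<Rightarrow> real) \<Rightarrow> real^'n \<Rightarrow> real^'n" where
  "grad u x = (if u differentiable at x then THE D. GDERIV u x :> D else 0)"

definition mixed_BV_modular ::
  "(real^'n) set \<Rightarrow> (real^'n \<Rightarrow> real) \<Rightarrow> (real^'n \<Rightarrow> real) \<Rightarrow> ennreal" where
  "mixed_BV_modular \<Omega> p u =
     Inf {liminf (\<lambda>i. \<integral>\<^sup>+ x. ennreal (norm (grad (v i) x) powr p x) \<partial>lebesgue_on \<Omega>) |v.
       (\<forall>i. v i \<in> Lip_loc \<Omega> \<inter> Lp_var \<Omega> p) \<and>
       (\<lambda>i. luxemburg_norm \<Omega> p (\<lambda>x. v i x - u x)) \<longlonglongrightarrow> 0}"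

definition mixed_BV :: "(real^'n) set \<Rightarrow> (real^'n \<Rightarrow> real) \<Rightarrow> (real^'n \<Rightarrow> real) set" where
  "mixed_BV \<Omega> p = {u \<in> Lp_var \<Omega> p. mixed_BV_modular \<Omega> p u < \<infinity>}"

definition admissible ::
  "(real^'n) set \<Rightarrow> (real^'n \<Rightarrow> real) \<Rightarrow> (real^'n) set \<Rightarrow> (real^'n \<Rightarrow> real) set" where
  "admissible \<Omega> p E = {u \<in> mixed_BV \<Omega> p.
     (AE x in lebesgue_on \<Omega>. 0 \<le> u x \<and> u x \<le> 1) \<and>
     (\<exists>U. open U \<and> E \<subseteq> U \<and> U \<subseteq> \<Omega> \<and> (AE x in lebesgue_on U. u x = 1))}"

definition mixed_capacity ::
  "(real^'n) set \<Rightarrow> (real^'n \<Rightarrow> real) \<Rightarrow> (real^'n) set \<Rightarrow> ennreal" where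
  "mixed_capacity \<Omega> p E = (INF u\<in>admissible \<Omega> p E. modular \<Omega> p u + mixed_BV_modular \<Omega> p u)"

definition choquet_capacity_on :: "'a::topological_space set \<Rightarrow> ('a set \<Rightarrow> ennreal) \<Rightarrow> bool" where
  "choquet_capacity_on \<Omega> c \<longleftrightarrow>
     (\<forall>A B. A \<subseteq> B \<longrightarrow> B \<subseteq> \<Omega> \<longrightarrow> c A \<le> c B) \<and>
     (\<forall>E. incseq E \<longrightarrow> (\<forall>i::nat. E i \<subseteq> \<Omega>) \<longrightarrow> (\<lambda>i. c (E i)) \<longlonglongrightarrow> c (\<Union>i. E i)) \<and>
     (\<forall>K. decseq K \<longrightarrow> (\<forall>i::nat. compact (K i) \<and> K i \<subseteq> \<Omega>) \<longrightarrow>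
        (\<lambda>i. c (K i)) \<longlonglongrightarrow> c (\<Inter>i. K i))"

end

theory Submission
  imports Defs
begin

text \<open>
  The crux is continuity along increasing sequences of arbitrary sets.  The energy
  \<open>J u = \<rho>\<^sub>p u + \<rho>\<^sub>B\<^sub>V u\<close> is strongly subadditive, \<open>J (max u v) + J (min u v) \<le> J u + J v\<close>, so running maxima of
  almost optimal functions for \<open>E\<^sub>i\<close> remain almost optimal; their limit is admissible for the union
  and does not raise the energy, because \<open>\<rho>\<^sub>B\<^sub>V\<close> is lower semicontinuous.  No compactness is used,
  which is what makes \<open>p = 1\<close> harmless.

  For a bounded exponent norm convergence is modular convergence, and all estimates are made with the modular.

  Rademacher's theorem and the measurability of gradients are both avoided: if \<open>{v - u = t}\<close> is null
  then the integrals of the gradients of \<open>max u (v - t)\<close> and \<open>min v (u + t)\<close> are pieced together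
  over two open sets, and a lower integral is additive over measurable sets whatever the integrand.

  Inner regularity for Borel sets is Choquet's capacitability theorem, with Borel sets represented as
  projections of closed subsets of \<open>X \<times> \<nat>\<^sup>\<nat>\<close>.
\<close>

section \<open>Capacitability of Borel sets\<close>

text \<open>The Souslin sets, with the closed witness \<open>Z\<close> living over the sequence
  space \<open>nat \<Rightarrow> nat\<close> in its product topology: countable operations become
  recodings of sequences, and bounding the entries of a sequence leads to compact sets.\<close>

definition analytic_set :: "'a::topological_space set \<Rightarrow> bool" where
  "analytic_set A \<longleftrightarrow> (\<exists>Z :: ('a \<times> (nat \<Rightarrow> nat)) set. closed Z \<and> A = fst ` Z)"

lemma closed_analytic_set: "closed F \<Longrightarrow> analytic_set F"
  unfolding analytic_set_def by (intro exI[of _ "F \<times> UNIV"]) (auto intro: closed_Times)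

text \<open>Both witness constructions below take preimages of closed sets under such maps: one
  reads a row of a doubly indexed sequence, the other drops the first entry.\<close>

lemma continuous_on_reindex_snd:
  "continuous_on UNIV (\<lambda>z :: 'a::topological_space \<times> ('i \<Rightarrow> 'b::topological_space).
     (fst z, \<lambda>k. snd z (f k)))"
proof (intro continuous_on_Pair continuous_on_fst continuous_on_id continuous_on_coordinatewise_then_product)
  fix k
  have "continuous_on UNIV (\<lambda>s :: 'i \<Rightarrow> 'b. s (f k))"
    by (rule continuous_on_product_coordinates)
  then show "continuous_on UNIV (\<lambda>z :: 'a \<times> ('i \<Rightarrow> 'b). snd z (f k))"
    by (rule continuous_on_compose2) (auto intro: continuous_intros)
qed

text \<open>One sequence stores countably many through \<open>prod_encode\<close>; its row
  \<open>n\<close> has to witness membership in \<open>A n\<close>.\<close>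

lemma analytic_set_INT:
  assumes "\<And>n::nat. analytic_set (A n)"
  shows "analytic_set (\<Inter>n. A n)"
proof -
  obtain Z where Z: "\<And>n. closed (Z n :: ('a \<times> (nat \<Rightarrow> nat)) set)" "\<And>n. A n = fst ` Z n"
    using assms unfolding analytic_set_def by metis
  define T where "T n z = (fst z, \<lambda>k. snd z (prod_encode (n, k)))"
    for n and z :: "'a \<times> (nat \<Rightarrow> nat)"
  have "closed (\<Inter>n. T n -` Z n)"
    using Z(1) unfolding T_def
    by (intro closed_INT ballI closed_vimage continuous_on_reindex_snd) auto
  moreover have "(\<Inter>n. A n) = fst ` (\<Inter>n. T n -` Z n)"
  proof
    show "(\<Inter>n. A n) \<subseteq> fst ` (\<Inter>n. T n -` Z n)"
    proof
      fix x assume "x \<in> (\<Inter>n. A n)"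
      then have "\<forall>n. \<exists>s. (x, s) \<in> Z n" using Z(2) by fastforce
      then obtain s where s: "\<And>n. (x, s n) \<in> Z n" by metis
      have "(x, \<lambda>j. case prod_decode j of (n, k) \<Rightarrow> s n k) \<in> (\<Inter>n. T n -` Z n)"
        using s by (auto simp: T_def)
      then show "x \<in> fst ` (\<Inter>n. T n -` Z n)" by force
    qed
    show "fst ` (\<Inter>n. T n -` Z n) \<subseteq> (\<Inter>n. A n)"
      using Z(2) by (force simp: T_def)
  qed
  ultimately show ?thesis unfolding analytic_set_def by blast
qed

text \<open>The first entry of the sequence names an index \<open>n\<close> and the tail witnesses
  membership in \<open>A n\<close>.\<close>

lemma analytic_set_UN:
  assumes "\<And>n::nat. analytic_set (A n)"
  shows "analytic_set (\<Union>n. A n)"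
proof -
  obtain Z where Z: "\<And>n. closed (Z n :: ('a \<times> (nat \<Rightarrow> nat)) set)" "\<And>n. A n = fst ` Z n"
    using assms unfolding analytic_set_def by metis
  define T where "T z = (fst z, \<lambda>k. snd z (Suc k))" for z :: "'a \<times> (nat \<Rightarrow> nat)"
  \<comment> \<open>The condition "if the first entry is \<open>n\<close>, then the tail is a
    witness in \<open>Z n\<close>" is written as an intersection of unions of two closed sets;
    \<open>- {n}\<close> is closed because \<open>nat\<close> is discrete.\<close>
  define Y where "Y = (\<Inter>n. (\<lambda>z. snd z 0) -` (- {n}) \<union> T -` Z n)"
  have "continuous_on UNIV (\<lambda>z :: 'a \<times> (nat \<Rightarrow> nat). snd z 0)"
    by (rule continuous_on_compose2[OF continuous_on_product_coordinates[of 0]]) (auto intro: continuous_intros)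
  then have "closed Y"
    using Z(1) unfolding Y_def T_def
    by (intro closed_INT ballI closed_Un closed_vimage continuous_on_reindex_snd)
      (auto intro: open_discrete simp: closed_def)
  moreover have "(\<Union>n. A n) = fst ` Y"
  proof
    show "(\<Union>n. A n) \<subseteq> fst ` Y"
    proof
      fix x assume "x \<in> (\<Union>n. A n)"
      then obtain n s where "(x, s) \<in> Z n" using Z(2) by fastforce
      then have "(x, case_nat n s) \<in> Y" by (auto simp: Y_def T_def)
      then show "x \<in> fst ` Y" by force
    qed
    show "fst ` Y \<subseteq> (\<Union>n. A n)"
      using Z(2) by (force simp: T_def Y_def)
  qed
  ultimately show ?thesis unfolding analytic_set_def by blast
qed

lemma open_analytic_set:
  fixes U :: "'a::euclidean_space set"
  assumes "open U"
  shows "analytic_set U"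
proof -
  obtain D where "\<And>n::nat. compact (D n)" "(\<Union>n. D n) = U"
    using open_Union_compact_subsets[OF assms] by metis
  then show ?thesis
    using analytic_set_UN[of D] closed_analytic_set compact_imp_closed by metis
qed

text \<open>Analytic sets are not closed under complements, so the induction over the generated
  sigma-algebra carries a set together with its complement.\<close>

lemma borel_analytic_set:
  fixes A :: "'a::euclidean_space set"
  assumes "A \<in> sets borel"
  shows "analytic_set A"
proof -
  have "A \<in> sigma_sets UNIV {S. open S}"
    using assms by (simp add: borel_def)
  then have "analytic_set A \<and> analytic_set (- A)"
  proof induction
    case (Union B)
    then show ?case using analytic_set_UN[of B] analytic_set_INT[of "\<lambda>n. - B n"] by simp
  qed (auto intro: open_analytic_set closed_analytic_set simp: Compl_eq_Diff_UNIV[symmetric])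
  then show ?thesis ..
qed

section \<open>Choquet's capacitability theorem\<close>

lemma tendsto_fun_iff_componentwise:
  fixes f :: "'b \<Rightarrow> 'i \<Rightarrow> 'a::topological_space"
  shows "(f \<longlongrightarrow> l) F \<longleftrightarrow> (\<forall>i. ((\<lambda>x. f x i) \<longlongrightarrow> l i) F)"
  using limitin_componentwise[of "\<lambda>_. euclidean" UNIV f l F]
  by (simp add: euclidean_product_topology)

text \<open>
  Choquet's argument: bounding the coordinates of \<open>\<sigma>\<close> one after the other costs arbitrarily little
  capacity, and once all of them are bounded the admissible \<open>\<sigma>\<close> form a compact set.
\<close>
lemma analytic_capacitable_within_compact:
  fixes c :: "'a::metric_space set \<Rightarrow> ennreal"
  assumes c: "choquet_capacity_on \<Omega> c" and A: "analytic_set A" "A \<subseteq> L"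
    and L: "compact L" "L \<subseteq> \<Omega>" and t: "t < c A"
  shows "\<exists>K\<subseteq>A. compact K \<and> t \<le> c K"
proof -
  obtain Z :: "('a \<times> (nat \<Rightarrow> nat)) set" where Z: "closed Z" "A = fst ` Z"
    using A(1) unfolding analytic_set_def by blast
  define P where "P m k = fst ` (Z \<inter> {z. \<forall>i<k. snd z i \<le> m i})" for m :: "nat \<Rightarrow> nat" and k
  have P_sub: "P m k \<subseteq> A" for m k by (auto simp: P_def Z)
  have P_cong: "P m k = P m' k" if "\<And>i. i < k \<Longrightarrow> m i = m' i" for m m' k
    using that by (auto simp: P_def)
  have inc: "(\<lambda>i. c (E i)) \<longlonglongrightarrow> c (\<Union>i. E i)" if "incseq E" "\<And>i. E i \<subseteq> \<Omega>" for E :: "nat \<Rightarrow> _"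
    using c that unfolding choquet_capacity_on_def by blast
  have dec: "(\<lambda>i. c (K i)) \<longlonglongrightarrow> c (\<Inter>i. K i)" if "decseq K" "\<And>i. compact (K i) \<and> K i \<subseteq> \<Omega>" for K :: "nat \<Rightarrow> _"
    using c that unfolding choquet_capacity_on_def by blast
  have mono: "c A \<le> c B" if "A \<subseteq> B" "B \<subseteq> \<Omega>" for A B
    using c that unfolding choquet_capacity_on_def by blast
  \<comment> \<open>Letting the bound \<open>j\<close> on the \<open>k\<close>-th entry grow
    exhausts \<open>P m k\<close>, so continuity along increasing sequences supplies a
    \<open>j\<close> that keeps the capacity above \<open>t\<close>.\<close>
  have step: "\<exists>j. t < c (P (m(k := j)) (Suc k))" if "t < c (P m k)" for m k
  proof -
    have eq: "P (m(k := j)) (Suc k) = fst ` (Z \<inter> {z. (\<forall>i<k. snd z i \<le> m i) \<and> snd z k \<le> j})" for j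
      unfolding P_def by (intro arg_cong[of _ _ "(`) fst"]) (auto simp: less_Suc_eq)
    have "incseq (\<lambda>j. P (m(k := j)) (Suc k))"
      unfolding eq incseq_def by (intro allI impI image_mono) auto
    then have "(\<lambda>j. c (P (m(k := j)) (Suc k))) \<longlonglongrightarrow> c (\<Union>j. P (m(k := j)) (Suc k))"
      using P_sub A(2) L(2) by (intro inc) blast+
    moreover have "(\<Union>j. P (m(k := j)) (Suc k)) = P m k"
      unfolding eq image_UN[symmetric] unfolding P_def by (intro arg_cong[of _ _ "(`) fst"]) auto
    ultimately have "\<forall>\<^sub>F j in sequentially. t < c (P (m(k := j)) (Suc k))"
      using that order_tendstoD(1) by simp
    then show ?thesis by (auto simp: eventually_sequentially)
  qed
  have "\<exists>M. \<forall>k. t < c (P (M k) k) \<and> (\<exists>j. M (Suc k) = (M k)(k := j))"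
  proof (rule dependent_nat_choice)
    show "\<exists>m. t < c (P m 0)" using t by (simp add: P_def Z)
  qed (use step in blast)
  then obtain M where M: "\<And>k. t < c (P (M k) k)" "\<And>k. \<exists>j. M (Suc k) = (M k)(k := j)"
    by blast
  \<comment> \<open>Entry \<open>i\<close> is set in passing from \<open>M i\<close> to
    \<open>M (Suc i)\<close> and left alone afterwards, so the stages agree with one limiting
    sequence of bounds.\<close>
  define m where "m i = M (Suc i) i" for i
  have M_m: "M k i = m i" if "i < k" for i k
    using that
  proof (induction k)
    case (Suc k)
    then show ?case using M(2)[of k] by (cases "i = k") (auto simp: m_def)
  qed simp
  have tP: "t < c (P m k)" for k
    using M(1)[of k] P_cong[of k "M k" m] M_m by simp
  \<comment> \<open>The sets \<open>P m k\<close> need not be compact; continuity along decreasing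
    sequences is applied to their closures, which are compact inside \<open>L\<close>. That the
    intersection of the closures stays in \<open>A\<close> is then the main point.\<close>
  define K where "K k = closure (P m k)" for k
  have KL: "K k \<subseteq> L" for k
    unfolding K_def using P_sub[of m k] A(2) L(1) by (intro closure_minimal) (auto intro: compact_imp_closed)
  have Kc: "compact (K k)" for k
    using KL L(1) compact_Int_closed[of L "K k"] by (simp add: K_def Int_absorb1)
  have "decseq K"
    unfolding decseq_def K_def by (intro allI impI closure_mono) (force simp: P_def)
  then have "(\<lambda>k. c (K k)) \<longlonglongrightarrow> c (\<Inter>k. K k)"
    using Kc KL L(2) by (intro dec) auto
  moreover have "t \<le> c (K k)" for k
    using tP[of k] mono[of "P m k" "K k"] KL[of k] L(2) closure_subset[of "P m k"]
    by (auto simp: K_def intro: less_imp_le order_trans)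
  ultimately have "t \<le> c (\<Inter>k. K k)"
    by (intro LIMSEQ_le_const) auto
  moreover have "(\<Inter>k. K k) \<subseteq> A"
  proof
    fix x assume x: "x \<in> (\<Inter>k. K k)"
    have "\<exists>z\<in>Z. (\<forall>i<k. snd z i \<le> m i) \<and> dist (fst z) x < inverse (Suc k)" for k
    proof -
      have "x \<in> closure (P m k)" using x by (auto simp: K_def)
      then obtain y where "y \<in> P m k" "dist y x < inverse (Suc k)"
        unfolding closure_approachable by (meson inverse_positive_iff_positive of_nat_0_less_iff zero_less_Suc)
      then show ?thesis by (auto simp: P_def)
    qed
    then obtain z where z: "\<And>k. z k \<in> Z" "\<And>k i. i < k \<Longrightarrow> snd (z k) i \<le> m i"
      "\<And>k. dist (fst (z k)) x < inverse (Suc k)" by metis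
    \<comment> \<open>The entries of \<open>snd (z k)\<close> are bounded only below index
      \<open>k\<close>. Cutting them off at \<open>m\<close> places the whole sequence in a compact
      box, and for each fixed \<open>i\<close> the cut changes nothing once \<open>k\<close> exceeds
      \<open>i\<close>.\<close>
    have "compact (PiE UNIV (\<lambda>i. {..m i}))"
      using compactin_PiE[of "\<lambda>_. euclidean" UNIV "\<lambda>i. {..m i}"]
      by (simp add: euclidean_product_topology finite_imp_compact)
    then have "seq_compact (PiE UNIV (\<lambda>i. {..m i}))"
      by (rule compact_imp_seq_compact)
    moreover have "\<forall>k. (\<lambda>i. min (snd (z k) i) (m i)) \<in> PiE UNIV (\<lambda>i. {..m i})"
      by auto
    ultimately obtain s r where s: "strict_mono r" "((\<lambda>k i. min (snd (z k) i) (m i)) \<circ> r) \<longlonglongrightarrow> s"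
      by (rule seq_compactE)
    have "(\<lambda>k. snd (z (r k)) i) \<longlonglongrightarrow> s i" for i
    proof -
      have "(\<lambda>k. min (snd (z (r k)) i) (m i)) \<longlonglongrightarrow> s i"
        using s(2) tendsto_fun_iff_componentwise[of "(\<lambda>k i. min (snd (z k) i) (m i)) \<circ> r" s sequentially]
        by (simp add: o_def)
      moreover have "\<forall>\<^sub>F k in sequentially. min (snd (z (r k)) i) (m i) = snd (z (r k)) i"
        using eventually_gt_at_top[of i]
      proof eventually_elim
        case (elim k)
        then show ?case
          using z(2)[of i "r k"] strict_mono_imp_increasing[OF s(1), of k] by simp
      qed
      ultimately show ?thesis by (rule Lim_transform_eventually)
    qed
    then have "(\<lambda>k. snd (z (r k))) \<longlonglongrightarrow> s"
      by (simp add: tendsto_fun_iff_componentwise)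
    moreover have "(\<lambda>k. fst (z (r k))) \<longlonglongrightarrow> x"
    proof -
      have "(\<lambda>k. dist (fst (z k)) x) \<longlonglongrightarrow> 0"
        by (rule tendsto_sandwich[OF _ _ tendsto_const LIMSEQ_inverse_real_of_nat])
          (intro always_eventually allI zero_le_dist less_imp_le z(3))+
      then have "(\<lambda>k. fst (z k)) \<longlonglongrightarrow> x" by (subst tendsto_dist_iff)
      then show ?thesis using LIMSEQ_subseq_LIMSEQ[OF _ s(1)] by (auto simp: o_def)
    qed
    ultimately have "(\<lambda>k. z (r k)) \<longlonglongrightarrow> (x, s)"
      using tendsto_Pair[of "\<lambda>k. fst (z (r k))" x sequentially "\<lambda>k. snd (z (r k))" s] by simp
    then have "(x, s) \<in> Z"
      by (rule closed_sequentially[OF Z(1) z(1)])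
    then show "x \<in> A" by (force simp: Z)
  qed
  moreover have "compact (\<Inter>k. K k)"
  proof -
    have "compact (K 0 \<inter> (\<Inter>k. K k))"
      using Kc by (intro compact_Int_closed closed_INT ballI compact_imp_closed)
    moreover have "K 0 \<inter> (\<Inter>k. K k) = (\<Inter>k. K k)" by blast
    ultimately show ?thesis by simp
  qed
  ultimately show ?thesis by (intro exI[of _ "\<Inter>k. K k"] conjI)
qed

text \<open>Exhausting the open set by compact sets \<open>D n\<close> reduces the claim to sets
  inside a compact set, since the capacities of \<open>A \<inter> D n\<close> tend to that of
  \<open>A\<close>.\<close>

theorem choquet_capacitability:
  fixes \<Omega> :: "'a::euclidean_space set"
  assumes c: "choquet_capacity_on \<Omega> c" and "open \<Omega>" and A: "A \<in> sets borel" "A \<subseteq> \<Omega>"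
  shows "c A = (SUP K\<in>{K. K \<subseteq> A \<and> compact K}. c K)"
proof (rule antisym)
  show "(SUP K\<in>{K. K \<subseteq> A \<and> compact K}. c K) \<le> c A"
    using c A(2) unfolding choquet_capacity_on_def by (intro SUP_least) auto
  show "c A \<le> (SUP K\<in>{K. K \<subseteq> A \<and> compact K}. c K)"
  proof (rule dense_le)
    fix t assume t: "t < c A"
    obtain D where D: "\<And>n. compact (D n)" "\<And>n. D n \<subseteq> interior (D (Suc n))" "(\<Union>n. D n) = \<Omega>"
      using open_Union_compact_subsets[OF \<open>open \<Omega>\<close>] by metis
    have "D n \<subseteq> D (Suc n)" for n
      using D(2)[of n] interior_subset by blast
    then have "incseq D" by (rule incseq_SucI)
    then have "incseq (\<lambda>n. A \<inter> D n)" by (fastforce simp: incseq_def)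
    then have "(\<lambda>n. c (A \<inter> D n)) \<longlonglongrightarrow> c (\<Union>n. A \<inter> D n)"
      using c A(2) unfolding choquet_capacity_on_def by blast
    also have "(\<Union>n. A \<inter> D n) = A"
      using A(2) D(3) by blast
    finally obtain n where n: "t < c (A \<inter> D n)"
      using t order_tendstoD(1) by (fastforce simp: eventually_sequentially)
    have "A \<inter> D n \<in> sets borel"
      using A(1) D(1) by (auto intro: borel_closed compact_imp_closed)
    then obtain K where "K \<subseteq> A \<inter> D n" "compact K" "t \<le> c K"
      using analytic_capacitable_within_compact[OF c borel_analytic_set, of "A \<inter> D n" "D n" t] n D by blast
    then show "t \<le> (SUP K\<in>{K. K \<subseteq> A \<and> compact K}. c K)"
      by (intro SUP_upper2[of K]) auto
  qed
qed

section \<open>Integration and gradients\<close>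

lemma less_add_ennreal: "a < top \<Longrightarrow> 0 < e \<Longrightarrow> a < a + ennreal e"
  using ennreal_add_left_cancel_less[of a 0 "ennreal e"] by auto

lemma abs_diff_triangle: "\<bar>a - c\<bar> \<le> \<bar>a - b\<bar> + \<bar>b - c\<bar>" for a b c :: real
  by linarith

text \<open>For approximants \<open>a\<close>, \<open>b\<close> of \<open>c\<close>,
  \<open>d\<close> the error splits into the cost of the shift and the cost of the approximation.
  The shift is charged \<open>min t \<bar>b - a\<bar>\<close> and not \<open>t\<close>, because a
  constant can have infinite modular on a domain of infinite measure.\<close>

lemma abs_max_shift_diff_le:
  fixes a b c d t :: real
  assumes "0 \<le> t"
  shows "\<bar>max a (b - t) - max c d\<bar> \<le> min t \<bar>b - a\<bar> + max \<bar>a - c\<bar> \<bar>b - d\<bar>"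
proof -
  have "\<bar>max a (b - t) - max a b\<bar> \<le> min t \<bar>b - a\<bar>"
    using assms by (auto simp: max_def min_def abs_if)
  moreover have "\<bar>max a b - max c d\<bar> \<le> max \<bar>a - c\<bar> \<bar>b - d\<bar>"
    by (auto simp: max_def abs_if)
  ultimately show ?thesis by (rule order_trans[OF abs_diff_triangle add_mono])
qed

lemma abs_min_shift_diff_le:
  fixes a b c d t :: real
  assumes "0 \<le> t"
  shows "\<bar>min b (a + t) - min c d\<bar> \<le> min t \<bar>b - a\<bar> + max \<bar>a - c\<bar> \<bar>b - d\<bar>"
proof -
  have "\<bar>min b (a + t) - min a b\<bar> \<le> min t \<bar>b - a\<bar>"
    using assms by (auto simp: min_def abs_if)
  moreover have "\<bar>min a b - min c d\<bar> \<le> max \<bar>a - c\<bar> \<bar>b - d\<bar>"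
    by (auto simp: min_def max_def abs_if)
  ultimately show ?thesis by (rule order_trans[OF abs_diff_triangle add_mono])
qed

lemma tendsto_0_le_ennreal:
  fixes f g :: "'a \<Rightarrow> ennreal"
  assumes "\<forall>\<^sub>F x in F. f x \<le> g x" "(g \<longlongrightarrow> 0) F"
  shows "(f \<longlongrightarrow> 0) F"
  by (rule tendsto_sandwich[of "\<lambda>_. 0" f F g]) (use assms in auto)

lemma tendsto_0_of_less_inverse:
  fixes f :: "nat \<Rightarrow> ennreal"
  assumes "\<And>n. f n < ennreal (inverse (real (Suc n)))"
  shows "f \<longlonglongrightarrow> 0"
proof -
  have "(\<lambda>n. ennreal (inverse (real (Suc n)))) \<longlonglongrightarrow> 0"
    using tendsto_ennrealI[OF LIMSEQ_inverse_real_of_nat] unfolding ennreal_0 .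
  then show ?thesis
    by (rule tendsto_0_le_ennreal[rotated]) (use assms in \<open>auto intro!: always_eventually less_imp_le\<close>)
qed

lemma liminf_add_le_ennreal:
  fixes f g :: "nat \<Rightarrow> ennreal"
  shows "liminf f + liminf g \<le> liminf (\<lambda>n. f n + g n)"
proof -
  have "liminf f + liminf g = (SUP n. (INF m\<in>{n..}. f m) + (INF m\<in>{n..}. g m))"
    unfolding liminf_SUP_INF
    by (intro ennreal_SUP_add[symmetric]) (auto simp: incseq_def intro!: INF_superset_mono)
  also have "\<dots> \<le> liminf (\<lambda>n. f n + g n)"
    unfolding liminf_SUP_INF by (intro SUP_mono' INF_greatest add_mono INF_lower)
  finally show ?thesis .
qed

text \<open>
  No measurability is required of \<open>f\<close>: the integral is the supremum of the integrals of the simple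
  functions below \<open>f\<close>, and simple functions can be glued along \<open>A\<close>.
\<close>
lemma nn_integral_split_set:
  assumes A [measurable]: "A \<in> sets M"
  shows "(\<integral>\<^sup>+x. f x \<partial>M) = (\<integral>\<^sup>+x. f x * indicator A x \<partial>M) + (\<integral>\<^sup>+x. f x * indicator (space M - A) x \<partial>M)"
    (is "_ = ?a + ?b")
proof (rule antisym)
  show "(\<integral>\<^sup>+x. f x \<partial>M) \<le> ?a + ?b"
    unfolding nn_integral_def[of M f]
  proof (rule SUP_least)
    fix g assume "g \<in> {g. simple_function M g \<and> g \<le> f}"
    then have g: "simple_function M g" "\<And>x. g x \<le> f x" by (auto simp: le_fun_def)
    note [measurable] = borel_measurable_simple_function[OF g(1)]
    have "integral\<^sup>S M g = (\<integral>\<^sup>+x. g x * indicator A x + g x * indicator (space M - A) x \<partial>M)"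
      unfolding nn_integral_eq_simple_integral[OF g(1), symmetric]
      by (intro nn_integral_cong) (auto split: split_indicator)
    also have "\<dots> = (\<integral>\<^sup>+x. g x * indicator A x \<partial>M) + (\<integral>\<^sup>+x. g x * indicator (space M - A) x \<partial>M)"
      by (intro nn_integral_add) measurable
    also have "\<dots> \<le> ?a + ?b"
      using g(2) by (intro add_mono nn_integral_mono mult_right_mono) auto
    finally show "integral\<^sup>S M g \<le> ?a + ?b" .
  qed
  let ?S = "\<lambda>h. {g. simple_function M g \<and> g \<le> h}"
  have ne: "?S h \<noteq> {}" for h :: "_ \<Rightarrow> ennreal"
    by (auto intro!: exI[of _ "\<lambda>_. 0"] simp: le_fun_def)
  show "?a + ?b \<le> (\<integral>\<^sup>+x. f x \<partial>M)"
    unfolding nn_integral_def[of M "\<lambda>x. f x * indicator A x"] ennreal_SUP_add_left[OF ne, symmetric]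
  proof (rule SUP_least)
    fix g assume g: "g \<in> ?S (\<lambda>x. f x * indicator A x)"
    show "integral\<^sup>S M g + ?b \<le> (\<integral>\<^sup>+x. f x \<partial>M)"
      unfolding nn_integral_def[of M "\<lambda>x. f x * indicator (space M - A) x"]
        add.commute[of "integral\<^sup>S M g"] ennreal_SUP_add_left[OF ne, symmetric]
    proof (rule SUP_least)
      fix h assume h: "h \<in> ?S (\<lambda>x. f x * indicator (space M - A) x)"
      have "h x + g x \<le> f x" for x
        using g h by (auto simp: le_fun_def split: split_indicator_asm dest!: spec[of _ x])
      moreover have "integral\<^sup>S M h + integral\<^sup>S M g = (\<integral>\<^sup>+x. h x + g x \<partial>M)"
        using g h by (simp add: nn_integral_eq_simple_integral[symmetric] nn_integral_add borel_measurable_simple_function)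
      ultimately show "integral\<^sup>S M h + integral\<^sup>S M g \<le> (\<integral>\<^sup>+x. f x \<partial>M)"
        by (simp add: nn_integral_mono)
    qed
  qed
qed

text \<open>A finite measure has at most countably many atoms. This is applied to the image under
  \<open>f\<close> of Lebesgue measure on \<open>S \<inter> ball 0 k\<close>, and then
  \<open>k\<close> runs through the naturals.\<close>

lemma countable_non_null_level_sets:
  fixes f :: "'a::euclidean_space \<Rightarrow> real"
  assumes f: "f \<in> borel_measurable (lebesgue_on S)" and S: "S \<in> sets lebesgue"
  shows "countable {t. emeasure lebesgue {x\<in>S. f x = t} \<noteq> 0}"
proof -
  define A where "A k = S \<inter> ball 0 (real k)" for k :: nat
  have A [measurable]: "A k \<in> sets lebesgue" for k
    unfolding A_def by (rule sets.Int[OF S fmeasurableD[OF lmeasurable_ball]])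
  have fA: "f \<in> borel_measurable (lebesgue_on (A k))" for k
    using measurable_restrict_mono[OF f] by (simp add: A_def)
  define N where "N k = distr (lebesgue_on (A k)) borel f" for k
  have level: "{x\<in>A k. f x = t} \<in> sets lebesgue" for k t
    using measurable_sets[OF fA[of k], of "{t}"] sets_restrict_space_iff[of "A k" lebesgue] A[of k]
    by (auto simp: vimage_def Int_def conj_commute)
  have N: "emeasure (N k) {t} = emeasure lebesgue {x\<in>A k. f x = t}" for k t
  proof -
    have "emeasure (N k) {t} = emeasure (lebesgue_on (A k)) {x\<in>A k. f x = t}"
      unfolding N_def by (subst emeasure_distr[OF fA]) (auto intro!: arg_cong2[of _ _ _ _ emeasure])
    also have "\<dots> = emeasure lebesgue {x\<in>A k. f x = t}"
      using A[of k] by (intro emeasure_restrict_space) auto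
    finally show ?thesis .
  qed
  have "finite_measure (N k)" for k
  proof
    have "emeasure lebesgue (A k) \<le> emeasure lebesgue (ball 0 (real k) :: 'a set)"
      by (intro emeasure_mono fmeasurableD[OF lmeasurable_ball]) (auto simp: A_def)
    also have "\<dots> < \<infinity>" using emeasure_bounded_finite[OF bounded_ball, of 0 "real k"] by simp
    finally show "emeasure (N k) (space (N k)) \<noteq> \<infinity>"
      using fA[of k] A[of k] unfolding N_def
      by (subst emeasure_distr) (auto simp: emeasure_restrict_space)
  qed
  then have "countable {t. emeasure (N k) {t} \<noteq> 0}" for k
    using finite_measure.countable_support[of "N k"] by (simp add: finite_measure.emeasure_eq_measure)
  then have "countable (\<Union>k. {t. emeasure (N k) {t} \<noteq> 0})" by auto
  moreover have "{t. emeasure lebesgue {x\<in>S. f x = t} \<noteq> 0} \<subseteq> (\<Union>k. {t. emeasure (N k) {t} \<noteq> 0})"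
  proof (rule subsetI, rule ccontr)
    fix t assume pos: "t \<in> {t. emeasure lebesgue {x\<in>S. f x = t} \<noteq> 0}"
      and null: "t \<notin> (\<Union>k. {t. emeasure (N k) {t} \<noteq> 0})"
    have "emeasure lebesgue {x\<in>A k. f x = t} = 0" for k
      using null unfolding N[symmetric] by blast
    then have "emeasure lebesgue (\<Union>k. {x\<in>A k. f x = t}) = 0"
      using level by (intro emeasure_UN_eq_0) auto
    moreover have "{x\<in>S. f x = t} = (\<Union>k. {x\<in>A k. f x = t})"
      using reals_Archimedean2 by (auto simp: A_def)
    ultimately show False using pos by simp
  qed
  ultimately show ?thesis by (rule countable_subset[rotated])
qed

text \<open>The value of \<open>grad\<close> is a description guarded by differentiability, so it
  suffices that \<open>f\<close> and \<open>g\<close> have exactly the same derivatives at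
  \<open>x\<close>, whether or not one exists.\<close>

lemma grad_cong_add_const:
  assumes "\<forall>\<^sub>F y in nhds x. f y = g y + c"
  shows "grad f x = grad g x"
proof -
  have f: "f x = g x + c" and ev: "\<forall>\<^sub>F y in at x. f y = g y + c"
    using assms eventually_nhds_x_imp_x eventually_nhds_conv_at by blast+
  have "(f has_derivative D) (at x) \<longleftrightarrow> (g has_derivative D) (at x)" for D
  proof
    assume "(f has_derivative D) (at x)"
    then have "((\<lambda>y. f y + - c) has_derivative D) (at x)"
      using has_derivative_add[OF _ has_derivative_const[of "- c"], of f D] by auto
    then show "(g has_derivative D) (at x)"
      by (rule has_derivative_transform_eventually) (use f ev in \<open>auto elim: eventually_mono\<close>)
  next
    assume "(g has_derivative D) (at x)"
    then have "((\<lambda>y. g y + c) has_derivative D) (at x)"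
      using has_derivative_add[OF _ has_derivative_const[of c], of g D] by auto
    then show "(f has_derivative D) (at x)"
      by (rule has_derivative_transform_eventually) (use f ev in \<open>auto elim: eventually_mono\<close>)
  qed
  then have "gderiv f x = gderiv g x" "f differentiable at x \<longleftrightarrow> g differentiable at x"
    by (simp_all add: gderiv_def differentiable_def fun_eq_iff)
  then show ?thesis by (simp add: grad_def)
qed

lemma Lip_loc_continuous_on:
  assumes "open \<Omega>" "u \<in> Lip_loc \<Omega>"
  shows "continuous_on \<Omega> u"
proof (rule continuous_at_imp_continuous_on, rule ballI)
  fix x assume x: "x \<in> \<Omega>"
  obtain r L where r: "0 < r" "L-lipschitz_on (ball x r \<inter> \<Omega>) u"
    using assms(2) x unfolding Lip_loc_def by blast
  then show "isCont u x"
    using assms(1) x lipschitz_on_continuous_on[OF r(2)]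
    by (simp add: continuous_on_eq_continuous_at open_Int)
qed

text \<open>The condition on \<open>w\<close> is shaped to cover shifted maxima and minima of
  \<open>u\<close> and \<open>v\<close> alike.\<close>

lemma Lip_loc_combine:
  assumes "u \<in> Lip_loc \<Omega>" "v \<in> Lip_loc \<Omega>"
    and w: "\<And>x y. \<bar>w x - w y\<bar> \<le> \<bar>u x - u y\<bar> + \<bar>v x - v y\<bar>"
  shows "w \<in> Lip_loc \<Omega>"
  unfolding Lip_loc_def
proof (intro CollectI ballI)
  fix x assume x: "x \<in> \<Omega>"
  obtain r L where u: "0 < r" "L-lipschitz_on (ball x r \<inter> \<Omega>) u"
    using assms(1) x unfolding Lip_loc_def by blast
  obtain s K where v: "0 < s" "K-lipschitz_on (ball x s \<inter> \<Omega>) v"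
    using assms(2) x unfolding Lip_loc_def by blast
  have "(L + K)-lipschitz_on (ball x (min r s) \<inter> \<Omega>) w"
  proof (rule lipschitz_onI)
    fix y z assume "y \<in> ball x (min r s) \<inter> \<Omega>" "z \<in> ball x (min r s) \<inter> \<Omega>"
    then have "dist (u y) (u z) \<le> L * dist y z" "dist (v y) (v z) \<le> K * dist y z"
      by (auto intro: lipschitz_onD[OF u(2)] lipschitz_onD[OF v(2)])
    then show "dist (w y) (w z) \<le> (L + K) * dist y z"
      using w[of y z] by (simp add: dist_real_def distrib_right)
  qed (use lipschitz_on_nonneg[OF u(2)] lipschitz_on_nonneg[OF v(2)] in simp)
  then show "\<exists>r>0. \<exists>L. L-lipschitz_on (ball x r \<inter> \<Omega>) w"
    using u(1) v(1) by (intro exI[of _ "min r s"]) auto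
qed

section \<open>The variable exponent modular\<close>

locale bounded_exponent =
  fixes \<Omega> :: "(real^'n) set" and p :: "real^'n \<Rightarrow> real" and P :: real
  assumes open_dom: "open \<Omega>"
    and p_measurable [measurable]: "p \<in> borel_measurable (lebesgue_on \<Omega>)"
    and p_ge_1: "x \<in> \<Omega> \<Longrightarrow> 1 \<le> p x"
    and p_le: "AE x in lebesgue_on \<Omega>. p x \<le> P"
begin

abbreviation "M \<equiv> lebesgue_on \<Omega>"

lemma AE_exponent: "AE x in M. 1 \<le> p x \<and> p x \<le> P"
  using p_le AE_space by eventually_elim (auto simp: p_ge_1)

lemma modular_mono:
  assumes "AE x in M. \<bar>u x\<bar> \<le> \<bar>v x\<bar>"
  shows "modular \<Omega> p u \<le> modular \<Omega> p v"
  unfolding modular_def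
  by (rule nn_integral_mono_AE, use assms AE_exponent in eventually_elim)
    (auto intro!: ennreal_leI powr_mono2)

lemma modular_scale:
  assumes [measurable]: "u \<in> borel_measurable M" and c: "0 \<le> c" "AE x in M. c powr p x \<le> k"
  shows "modular \<Omega> p (\<lambda>x. c * u x) \<le> ennreal k * modular \<Omega> p u"
proof -
  have "modular \<Omega> p (\<lambda>x. c * u x) \<le> (\<integral>\<^sup>+x. ennreal k * ennreal (\<bar>u x\<bar> powr p x) \<partial>M)"
    unfolding modular_def
  proof (rule nn_integral_mono_AE, use c(2) in eventually_elim)
    fix x assume x: "c powr p x \<le> k"
    then have "0 \<le> k" using order_trans powr_ge_zero by blast
    then show "ennreal (\<bar>c * u x\<bar> powr p x) \<le> ennreal k * ennreal (\<bar>u x\<bar> powr p x)"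
      using x c(1) by (auto simp: abs_mult powr_mult ennreal_mult[symmetric] intro!: ennreal_leI mult_right_mono)
  qed
  then show ?thesis unfolding modular_def by (simp add: nn_integral_cmult)
qed

text \<open>As exponents are at least 1, \<open>c powr p x \<le> c\<close> for \<open>c\<close> in
  the unit interval. This and the opposite bound \<open>modular_expand\<close>, which rests on
  \<open>p \<le> P\<close>, are what make norm and modular convergence equivalent.\<close>

lemma modular_contract:
  assumes "u \<in> borel_measurable M" "0 \<le> c" "c \<le> 1"
  shows "modular \<Omega> p (\<lambda>x. c * u x) \<le> ennreal c * modular \<Omega> p u"
proof (rule modular_scale)
  show "AE x in M. c powr p x \<le> c"
    using AE_exponent
  proof eventually_elim
    case (elim x)
    then show ?case using assms powr_mono'[of 1 "p x" c] by (cases "c = 0") auto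
  qed
qed (use assms in auto)

lemma modular_expand:
  assumes "u \<in> borel_measurable M" "1 \<le> c"
  shows "modular \<Omega> p (\<lambda>x. c * u x) \<le> ennreal (c powr P) * modular \<Omega> p u"
proof (rule modular_scale)
  show "AE x in M. c powr p x \<le> c powr P"
    using AE_exponent by eventually_elim (use assms in \<open>auto intro: powr_mono\<close>)
qed (use assms in auto)

text \<open>The power of a maximum is one of the two powers, hence at most their sum; no constant is
  lost.\<close>

lemma modular_le_max:
  assumes [measurable]: "u \<in> borel_measurable M" "v \<in> borel_measurable M"
    and w: "AE x in M. \<bar>w x\<bar> \<le> max \<bar>u x\<bar> \<bar>v x\<bar>"
  shows "modular \<Omega> p w \<le> modular \<Omega> p u + modular \<Omega> p v"
proof -
  have "modular \<Omega> p w \<le> (\<integral>\<^sup>+x. ennreal (\<bar>u x\<bar> powr p x) + ennreal (\<bar>v x\<bar> powr p x) \<partial>M)"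
    unfolding modular_def
  proof (rule nn_integral_mono_AE, use w AE_exponent in eventually_elim)
    case (elim x)
    then have "\<bar>w x\<bar> powr p x \<le> (max \<bar>u x\<bar> \<bar>v x\<bar>) powr p x" by (intro powr_mono2) auto
    also have "\<dots> \<le> \<bar>u x\<bar> powr p x + \<bar>v x\<bar> powr p x" by (simp add: max_def)
    finally show ?case by (simp add: ennreal_plus[symmetric] ennreal_leI del: ennreal_plus)
  qed
  then show ?thesis unfolding modular_def by (simp add: nn_integral_add)
qed

text \<open>The factor arises from \<open>\<bar>u\<bar> + \<bar>v\<bar> \<le> 2 * max \<bar>u\<bar>
  \<bar>v\<bar>\<close>.\<close>

lemma modular_triangle:
  assumes [measurable]: "u \<in> borel_measurable M" "v \<in> borel_measurable M"
    and w: "AE x in M. \<bar>w x\<bar> \<le> \<bar>u x\<bar> + \<bar>v x\<bar>"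
  shows "modular \<Omega> p w \<le> ennreal (2 powr P) * (modular \<Omega> p u + modular \<Omega> p v)"
proof -
  have "modular \<Omega> p w \<le> modular \<Omega> p (\<lambda>x. 2 * u x) + modular \<Omega> p (\<lambda>x. 2 * v x)"
    by (rule modular_le_max) (use w in \<open>auto elim!: eventually_mono\<close>)
  also have "\<dots> \<le> ennreal (2 powr P) * modular \<Omega> p u + ennreal (2 powr P) * modular \<Omega> p v"
    by (intro add_mono modular_expand) auto
  finally show ?thesis by (simp add: distrib_left)
qed

text \<open>Two errors of this size, multiplied by the constant \<open>2 powr P\<close> of
  \<open>modular_triangle\<close>, add up to \<open>d / 2\<close>, strictly below a positive
  \<open>d\<close>.\<close>

definition half_tol :: "real \<Rightarrow> real" where "half_tol d = d / (4 * 2 powr P)"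

lemma half_tol_pos: "0 < d \<Longrightarrow> 0 < half_tol d"
  by (simp add: half_tol_def)

lemma modular_triangle_less:
  assumes [measurable]: "u \<in> borel_measurable M" "v \<in> borel_measurable M"
    and w: "AE x in M. \<bar>w x\<bar> \<le> \<bar>u x\<bar> + \<bar>v x\<bar>"
    and small: "modular \<Omega> p u < ennreal (half_tol d)" "modular \<Omega> p v < ennreal (half_tol d)" and d: "0 < d"
  shows "modular \<Omega> p w < ennreal d"
proof -
  have "modular \<Omega> p w \<le> ennreal (2 powr P) * (modular \<Omega> p u + modular \<Omega> p v)"
    by (rule modular_triangle) (use w in auto)
  also have "\<dots> \<le> ennreal (2 powr P) * (ennreal (half_tol d) + ennreal (half_tol d))"
    using small by (intro mult_left_mono add_mono) auto
  also have "\<dots> = ennreal (d / 2)"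
    using d half_tol_pos[OF d]
    by (simp add: ennreal_plus[symmetric] ennreal_mult[symmetric] half_tol_def field_simps del: ennreal_plus)
  also have "\<dots> < ennreal d" using d by (intro ennreal_lessI) auto
  finally show ?thesis .
qed

text \<open>For a bounded exponent, finiteness at one scale \<open>l\<close> gives finiteness at
  scale 1. The factor is \<open>max 1 l\<close> because \<open>modular_expand\<close> asks for a
  factor at least 1.\<close>

lemma Lp_var_iff: "u \<in> Lp_var \<Omega> p \<longleftrightarrow> u \<in> borel_measurable M \<and> modular \<Omega> p u < \<infinity>"
proof
  assume "u \<in> Lp_var \<Omega> p"
  then obtain l where u [measurable]: "u \<in> borel_measurable M" and l: "0 < l" "modular \<Omega> p (\<lambda>x. u x / l) < \<infinity>"
    unfolding Lp_var_def by blast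
  have "modular \<Omega> p u \<le> modular \<Omega> p (\<lambda>x. max 1 l * (u x / l))"
  proof (rule modular_mono, rule AE_I2)
    fix x
    have "\<bar>u x\<bar> = l * (\<bar>u x\<bar> / l)" using l by simp
    also have "\<dots> \<le> max 1 l * (\<bar>u x\<bar> / l)" using l by (intro mult_right_mono) auto
    finally show "\<bar>u x\<bar> \<le> \<bar>max 1 l * (u x / l)\<bar>" using l by (simp add: abs_mult)
  qed
  also have "\<dots> \<le> ennreal (max 1 l powr P) * modular \<Omega> p (\<lambda>x. u x / l)"
    by (rule modular_expand) auto
  also have "\<dots> < \<infinity>" using l by (simp add: ennreal_mult_less_top)
  finally show "u \<in> borel_measurable M \<and> modular \<Omega> p u < \<infinity>" by simp
qed (auto simp: Lp_var_def intro!: exI[of _ 1])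

lemma Lp_var_dominated:
  assumes "u \<in> Lp_var \<Omega> p" "v \<in> Lp_var \<Omega> p" "w \<in> borel_measurable M"
    and "\<And>x. \<bar>w x\<bar> \<le> \<bar>u x\<bar> + \<bar>v x\<bar>"
  shows "w \<in> Lp_var \<Omega> p"
proof -
  have "modular \<Omega> p w \<le> ennreal (2 powr P) * (modular \<Omega> p u + modular \<Omega> p v)"
    using assms by (intro modular_triangle) (auto simp: Lp_var_iff)
  also have "\<dots> < \<infinity>" using assms by (simp add: Lp_var_iff ennreal_mult_less_top)
  finally show ?thesis using assms by (simp add: Lp_var_iff)
qed

lemma Lp_var_diff:
  assumes "u \<in> Lp_var \<Omega> p" "v \<in> Lp_var \<Omega> p"
  shows "(\<lambda>x. u x - v x) \<in> Lp_var \<Omega> p"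
  by (rule Lp_var_dominated[OF assms]) (use assms in \<open>auto simp: Lp_var_iff\<close>)

lemma Lp_var_max_min:
  assumes "u \<in> Lp_var \<Omega> p" "v \<in> Lp_var \<Omega> p"
  shows "(\<lambda>x. max (u x) (v x)) \<in> Lp_var \<Omega> p" "(\<lambda>x. min (u x) (v x)) \<in> Lp_var \<Omega> p"
  by (rule Lp_var_dominated[OF assms]; use assms in \<open>auto simp: Lp_var_iff\<close>)+

section \<open>Luxemburg norm and modular\<close>

lemma luxemburg_set_nonempty:
  assumes "w \<in> Lp_var \<Omega> p"
  shows "\<exists>l. 0 < l \<and> modular \<Omega> p (\<lambda>x. w x / l) \<le> 1"
proof -
  obtain m where m: "modular \<Omega> p w = ennreal m" "0 \<le> m"
    using assms unfolding Lp_var_iff by (cases "modular \<Omega> p w") auto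
  \<comment> \<open>Division by \<open>1 + m\<close> works since contraction leaves a modular of at
    most \<open>m / (1 + m)\<close>; the 1 also keeps the divisor positive when
    \<open>m = 0\<close>.\<close>
  have "modular \<Omega> p (\<lambda>x. inverse (1 + m) * w x) \<le> ennreal (inverse (1 + m)) * modular \<Omega> p w"
    using assms m by (intro modular_contract) (auto simp: Lp_var_iff field_simps)
  also have "\<dots> \<le> 1"
    using m by (simp add: ennreal_mult[symmetric] field_simps)
  finally show ?thesis using m by (intro exI[of _ "1 + m"]) (simp add: field_simps)
qed

lemma luxemburg_norm_nonneg: "w \<in> Lp_var \<Omega> p \<Longrightarrow> 0 \<le> luxemburg_norm \<Omega> p w"
  unfolding luxemburg_norm_def using luxemburg_set_nonempty by (intro cInf_greatest) auto

text \<open>A competitor \<open>l\<close> slightly above the norm can still be chosen below 1, and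
  then \<open>modular_contract\<close> bounds the modular by \<open>l\<close>.\<close>

lemma modular_le_luxemburg_norm:
  assumes w: "w \<in> Lp_var \<Omega> p" "luxemburg_norm \<Omega> p w < 1"
  shows "modular \<Omega> p w \<le> ennreal (luxemburg_norm \<Omega> p w)"
proof (rule ennreal_le_epsilon)
  fix e :: real assume e: "0 < e"
  let ?N = "luxemburg_norm \<Omega> p w"
  have "Inf {l. 0 < l \<and> modular \<Omega> p (\<lambda>x. w x / l) \<le> 1} < min 1 (?N + e)"
    using w e by (simp add: luxemburg_norm_def)
  then obtain l where l: "0 < l" "modular \<Omega> p (\<lambda>x. w x / l) \<le> 1" "l < 1" "l < ?N + e"
    using luxemburg_set_nonempty[OF w(1)] by (subst (asm) cInf_less_iff) (auto intro!: bdd_belowI[of _ 0])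
  have "modular \<Omega> p w = modular \<Omega> p (\<lambda>x. l * (w x / l))" using l by simp
  also have "\<dots> \<le> ennreal l * modular \<Omega> p (\<lambda>x. w x / l)"
    using w l by (intro modular_contract) (auto simp: Lp_var_iff)
  also have "\<dots> \<le> ennreal l * 1" using l by (intro mult_left_mono) auto
  also have "\<dots> \<le> ennreal (?N + e)" using l by (simp add: ennreal_leI)
  finally show "modular \<Omega> p w \<le> ennreal ?N + ennreal e"
    using luxemburg_norm_nonneg[OF w(1)] e by simp
qed

text \<open>Expanding by \<open>inverse r\<close> costs at most \<open>inverse r powr P\<close>, so
  \<open>r\<close> itself is a competitor in the infimum.\<close>

lemma luxemburg_norm_le:
  assumes w: "w \<in> Lp_var \<Omega> p" and r: "0 < r" "r \<le> 1" "modular \<Omega> p w \<le> ennreal (r powr P)"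
  shows "luxemburg_norm \<Omega> p w \<le> r"
proof -
  have "modular \<Omega> p (\<lambda>x. inverse r * w x) \<le> ennreal (inverse r powr P) * modular \<Omega> p w"
    using w r by (intro modular_expand) (auto simp: Lp_var_iff one_le_inverse)
  also have "\<dots> \<le> ennreal (inverse r powr P) * ennreal (r powr P)"
    using r by (intro mult_left_mono) auto
  also have "\<dots> = 1"
    using r by (simp add: ennreal_mult[symmetric] powr_mult[symmetric])
  finally show ?thesis
    unfolding luxemburg_norm_def using r
    by (intro cInf_lower) (auto intro!: bdd_belowI[of _ 0] simp: field_simps)
qed

lemma luxemburg_norm_tendsto_0_iff:
  fixes w :: "nat \<Rightarrow> real^'n \<Rightarrow> real"
  assumes w: "\<And>i. w i \<in> Lp_var \<Omega> p"
  shows "(\<lambda>i. luxemburg_norm \<Omega> p (w i)) \<longlonglongrightarrow> 0 \<longleftrightarrow> (\<lambda>i. modular \<Omega> p (w i)) \<longlonglongrightarrow> 0"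
proof
  assume lim: "(\<lambda>i. luxemburg_norm \<Omega> p (w i)) \<longlonglongrightarrow> 0"
  have "\<forall>\<^sub>F i in sequentially. modular \<Omega> p (w i) \<le> ennreal (luxemburg_norm \<Omega> p (w i))"
    using order_tendstoD(2)[OF lim zero_less_one]
    by eventually_elim (rule modular_le_luxemburg_norm[OF w])
  moreover have "(\<lambda>i. ennreal (luxemburg_norm \<Omega> p (w i))) \<longlonglongrightarrow> 0"
    using tendsto_ennrealI[OF lim] by simp
  ultimately show "(\<lambda>i. modular \<Omega> p (w i)) \<longlonglongrightarrow> 0"
    by (rule tendsto_0_le_ennreal)
next
  assume lim: "(\<lambda>i. modular \<Omega> p (w i)) \<longlonglongrightarrow> 0"
  show "(\<lambda>i. luxemburg_norm \<Omega> p (w i)) \<longlonglongrightarrow> 0"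
  proof (rule order_tendstoI)
    fix a :: real assume "a < 0"
    then show "\<forall>\<^sub>F i in sequentially. a < luxemburg_norm \<Omega> p (w i)"
      using less_le_trans[OF _ luxemburg_norm_nonneg[OF w]] by (intro always_eventually allI)
  next
    fix a :: real assume a: "0 < a"
    define r where "r = min 1 (a / 2)"
    have r: "0 < r" "r \<le> 1" "r < a" using a by (auto simp: r_def)
    then have "\<forall>\<^sub>F i in sequentially. modular \<Omega> p (w i) < ennreal (r powr P)"
      by (intro order_tendstoD(2)[OF lim]) auto
    then show "\<forall>\<^sub>F i in sequentially. luxemburg_norm \<Omega> p (w i) < a"
      by eventually_elim (use luxemburg_norm_le[OF w] r in \<open>auto intro: le_less_trans less_imp_le\<close>)
  qed
qed

section \<open>Gradient energy and its relaxation: single approximants and lower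
  semicontinuity\<close>

definition energy :: "(real^'n \<Rightarrow> real) \<Rightarrow> ennreal" where
  "energy v = (\<integral>\<^sup>+x. ennreal (norm (grad v x) powr p x) \<partial>M)"

abbreviation "Lip_Lp \<equiv> Lip_loc \<Omega> \<inter> Lp_var \<Omega> p"

lemma mixed_BV_modular_alt:
  assumes u: "u \<in> Lp_var \<Omega> p"
  shows "mixed_BV_modular \<Omega> p u =
    Inf {liminf (\<lambda>i. energy (v i)) |v. (\<forall>i. v i \<in> Lip_Lp) \<and> (\<lambda>i. modular \<Omega> p (\<lambda>x. v i x - u x)) \<longlonglongrightarrow> 0}"
proof -
  have "(\<forall>i. v i \<in> Lip_Lp) \<and> (\<lambda>i. luxemburg_norm \<Omega> p (\<lambda>x. v i x - u x)) \<longlonglongrightarrow> 0 \<longleftrightarrow>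
      (\<forall>i. v i \<in> Lip_Lp) \<and> (\<lambda>i. modular \<Omega> p (\<lambda>x. v i x - u x)) \<longlonglongrightarrow> 0" for v :: "nat \<Rightarrow> _"
    using luxemburg_norm_tendsto_0_iff[of "\<lambda>i x. v i x - u x"] Lp_var_diff[OF _ u] by blast
  then show ?thesis unfolding mixed_BV_modular_def energy_def[symmetric] by (simp only:)
qed

lemma mixed_BV_modular_le_liminf:
  assumes "u \<in> Lp_var \<Omega> p" "\<And>i. v i \<in> Lip_Lp" "(\<lambda>i. modular \<Omega> p (\<lambda>x. v i x - u x)) \<longlonglongrightarrow> 0"
  shows "mixed_BV_modular \<Omega> p u \<le> liminf (\<lambda>i. energy (v i))"
  unfolding mixed_BV_modular_alt[OF assms(1)] using assms by (intro Inf_lower) blast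

text \<open>Together with \<open>mixed_BV_modular_leI\<close> this trades sequences for one
  approximant at each accuracy \<open>d\<close>. A liminf below \<open>c\<close> puts infinitely
  many energies below \<open>c\<close>, and some of their indices lie far enough out for accuracy
  \<open>d\<close>.\<close>

lemma mixed_BV_modular_lessD:
  assumes u: "u \<in> Lp_var \<Omega> p" and less: "mixed_BV_modular \<Omega> p u < c" and d: "0 < d"
  shows "\<exists>v\<in>Lip_Lp. modular \<Omega> p (\<lambda>x. v x - u x) < ennreal d \<and> energy v < c"
proof -
  obtain v where v: "\<And>i. v i \<in> Lip_Lp" "(\<lambda>i. modular \<Omega> p (\<lambda>x. v i x - u x)) \<longlonglongrightarrow> 0"
    and less: "liminf (\<lambda>i. energy (v i)) < c"
    using less unfolding mixed_BV_modular_alt[OF u] Inf_less_iff by blast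
  have "\<exists>\<^sub>F i in sequentially. energy (v i) < c"
  proof (rule ccontr)
    assume "\<not> ?thesis"
    then have "c \<le> liminf (\<lambda>i. energy (v i))"
      by (intro Liminf_bounded) (simp add: not_frequently not_less)
    then show False using less by simp
  qed
  moreover have "\<forall>\<^sub>F i in sequentially. modular \<Omega> p (\<lambda>x. v i x - u x) < ennreal d"
    using d by (intro order_tendstoD(2)[OF v(2)]) auto
  ultimately obtain i where "modular \<Omega> p (\<lambda>x. v i x - u x) < ennreal d" "energy (v i) < c"
    using frequently_ex[OF frequently_eventually_conj] by fastforce
  then show ?thesis using v(1) by blast
qed

lemma mixed_BV_modular_leI:
  assumes u: "u \<in> Lp_var \<Omega> p"
    and ex: "\<And>d. 0 < d \<Longrightarrow> \<exists>v\<in>Lip_Lp. modular \<Omega> p (\<lambda>x. v x - u x) < ennreal d \<and> energy v \<le> c"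
  shows "mixed_BV_modular \<Omega> p u \<le> c"
proof -
  have "\<forall>n. \<exists>v\<in>Lip_Lp. modular \<Omega> p (\<lambda>x. v x - u x) < ennreal (inverse (real (Suc n))) \<and> energy v \<le> c"
    by (intro allI ex) simp
  then obtain v where v: "\<And>n. v n \<in> Lip_Lp" "\<And>n. modular \<Omega> p (\<lambda>x. v n x - u x) < ennreal (inverse (real (Suc n)))"
    "\<And>n. energy (v n) \<le> c" by metis
  have "mixed_BV_modular \<Omega> p u \<le> liminf (\<lambda>n. energy (v n))"
    using v by (intro mixed_BV_modular_le_liminf u tendsto_0_of_less_inverse) auto
  also have "\<dots> \<le> c" using v(3) by (intro Liminf_le) auto
  finally show ?thesis .
qed

text \<open>A diagonal argument: pick \<open>ui i\<close> close to \<open>u\<close> with relaxed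
  energy below \<open>c\<close>, then a Lipschitz approximant of \<open>ui i\<close> with energy
  below \<open>c\<close>.\<close>

lemma mixed_BV_modular_lsc:
  assumes u: "u \<in> Lp_var \<Omega> p" and ui: "\<And>i. ui i \<in> Lp_var \<Omega> p"
    and lim: "(\<lambda>i. modular \<Omega> p (\<lambda>x. ui i x - u x)) \<longlonglongrightarrow> 0"
  shows "mixed_BV_modular \<Omega> p u \<le> liminf (\<lambda>i. mixed_BV_modular \<Omega> p (ui i))"
proof (rule dense_ge)
  fix c assume c: "liminf (\<lambda>i. mixed_BV_modular \<Omega> p (ui i)) < c"
  have freq: "\<exists>\<^sub>F i in sequentially. mixed_BV_modular \<Omega> p (ui i) < c"
  proof (rule ccontr)
    assume "\<not> ?thesis"
    then have "c \<le> liminf (\<lambda>i. mixed_BV_modular \<Omega> p (ui i))"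
      by (intro Liminf_bounded) (simp add: not_frequently not_less)
    then show False using c by simp
  qed
  show "mixed_BV_modular \<Omega> p u \<le> c"
  proof (rule mixed_BV_modular_leI[OF u])
    fix d :: real assume d: "0 < d"
    have "\<forall>\<^sub>F i in sequentially. modular \<Omega> p (\<lambda>x. ui i x - u x) < ennreal (half_tol d)"
      using half_tol_pos[OF d] by (intro order_tendstoD(2)[OF lim]) auto
    then obtain i where i: "modular \<Omega> p (\<lambda>x. ui i x - u x) < ennreal (half_tol d)" "mixed_BV_modular \<Omega> p (ui i) < c"
      using frequently_ex[OF frequently_eventually_conj[OF freq]] by fastforce
    obtain v where v: "v \<in> Lip_Lp" "modular \<Omega> p (\<lambda>x. v x - ui i x) < ennreal (half_tol d)" "energy v < c"
      using mixed_BV_modular_lessD[OF ui i(2) half_tol_pos[OF d]] by blast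
    have "modular \<Omega> p (\<lambda>x. v x - u x) < ennreal d"
    proof (rule modular_triangle_less[OF _ _ _ v(2) i(1) d])
      have [measurable]: "v \<in> borel_measurable M" "u \<in> borel_measurable M" "ui i \<in> borel_measurable M"
        using v(1) u ui[of i] by (simp_all add: Lp_var_iff)
      show "(\<lambda>x. v x - ui i x) \<in> borel_measurable M" "(\<lambda>x. ui i x - u x) \<in> borel_measurable M"
        by measurable
    qed auto
    then show "\<exists>v\<in>Lip_Lp. modular \<Omega> p (\<lambda>x. v x - u x) < ennreal d \<and> energy v \<le> c"
      using v by (auto intro: less_imp_le)
  qed
qed

section \<open>Strong subadditivity of the relaxed energy\<close>

text \<open>Dominated convergence with majorant \<open>\<bar>w x\<bar> powr p x\<close>, which works
  on domains of infinite measure too.\<close>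

lemma modular_truncation_small:
  assumes w: "w \<in> Lp_var \<Omega> p" and d: "0 < d"
  shows "\<exists>s>0. \<forall>t. 0 \<le> t \<and> t \<le> s \<longrightarrow> modular \<Omega> p (\<lambda>x. min t \<bar>w x\<bar>) < ennreal d"
proof -
  have [measurable]: "w \<in> borel_measurable M" and fin: "modular \<Omega> p w < \<infinity>"
    using w by (auto simp: Lp_var_iff)
  define s where "s n = inverse (real (Suc n))" for n
  have s: "0 < s n" for n by (simp add: s_def)
  have "(\<lambda>n. \<integral>\<^sup>+x. ennreal (\<bar>min (s n) \<bar>w x\<bar>\<bar> powr p x) \<partial>M) \<longlonglongrightarrow> (\<integral>\<^sup>+x. 0 \<partial>M)"
  proof (rule nn_integral_dominated_convergence[where w = "\<lambda>x. ennreal (\<bar>w x\<bar> powr p x)"])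
    show "AE x in M. ennreal (\<bar>min (s n) \<bar>w x\<bar>\<bar> powr p x) \<le> ennreal (\<bar>w x\<bar> powr p x)" for n
      using AE_exponent by eventually_elim (use s[of n] in \<open>auto intro!: ennreal_leI powr_mono2\<close>)
    show "AE x in M. (\<lambda>n. ennreal (\<bar>min (s n) \<bar>w x\<bar>\<bar> powr p x)) \<longlonglongrightarrow> 0"
      using AE_exponent
    proof eventually_elim
      case (elim x)
      have "(\<lambda>n. \<bar>min (s n) \<bar>w x\<bar>\<bar>) \<longlonglongrightarrow> \<bar>min 0 \<bar>w x\<bar>\<bar>"
        unfolding s_def by (intro tendsto_intros LIMSEQ_inverse_real_of_nat)
      then have "(\<lambda>n. \<bar>min (s n) \<bar>w x\<bar>\<bar> powr p x) \<longlonglongrightarrow> 0 powr p x"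
        using elim by (intro tendsto_powr') auto
      then show ?case using tendsto_ennrealI by fastforce
    qed
  qed (use fin in \<open>auto simp: modular_def\<close>)
  then have "\<forall>\<^sub>F n in sequentially. modular \<Omega> p (\<lambda>x. min (s n) \<bar>w x\<bar>) < ennreal d"
    using d unfolding modular_def by (intro order_tendstoD(2)[where y = 0]) auto
  then obtain n where n: "modular \<Omega> p (\<lambda>x. min (s n) \<bar>w x\<bar>) < ennreal d"
    by (auto simp: eventually_sequentially)
  \<comment> \<open>Monotonicity extends the bound from the sequence \<open>s n\<close> to a whole
    interval, in which a generic shift can be chosen later.\<close>
  have "modular \<Omega> p (\<lambda>x. min t \<bar>w x\<bar>) < ennreal d" if "0 \<le> t" "t \<le> s n" for t
    by (rule le_less_trans[OF modular_mono n]) (use that in auto)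
  then show ?thesis using s by blast
qed

text \<open>On \<open>A\<close> the maximum is \<open>v - t\<close> and the minimum is
  \<open>u + t\<close>; on \<open>B\<close> they are \<open>u\<close> and \<open>v\<close>. Each of
  the two takes the gradient of one function on \<open>A\<close> and of the other on
  \<open>B\<close>, and the four pieces regroup into the energies of \<open>u\<close> and
  \<open>v\<close>.\<close>

lemma energy_max_min_shift:
  assumes u: "u \<in> Lip_loc \<Omega>" and v: "v \<in> Lip_loc \<Omega>"
    and t: "emeasure lebesgue {x\<in>\<Omega>. v x - u x = t} = 0"
  shows "energy (\<lambda>x. max (u x) (v x - t)) + energy (\<lambda>x. min (v x) (u x + t)) = energy u + energy v"
proof -
  define A where "A = {x\<in>\<Omega>. t < v x - u x}"
  define B where "B = {x\<in>\<Omega>. v x - u x < t}"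
  define e where "e f x = ennreal (norm (grad f x) powr p x)" for f x
  have cont: "continuous_on \<Omega> (\<lambda>x. v x - u x)"
    by (intro continuous_on_diff Lip_loc_continuous_on open_dom u v)
  have "A = \<Omega> \<inter> (\<lambda>x. v x - u x) -` {t<..}" "B = \<Omega> \<inter> (\<lambda>x. v x - u x) -` {..<t}"
    by (auto simp: A_def B_def)
  then have op: "open A" "open B"
    using continuous_open_preimage[OF cont open_dom] by auto
  have [measurable]: "A \<in> sets M"
    using op(1) open_dom by (auto simp: sets_restrict_space_iff A_def)
  have level: "{x\<in>\<Omega>. v x - u x = t} \<in> sets lebesgue"
  proof -
    have "{x\<in>\<Omega>. v x - u x = t} = \<Omega> - (A \<union> B)" by (auto simp: A_def B_def)
    then show ?thesis using op open_dom by auto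
  qed
  then have AB: "AE x in M. x \<in> A \<or> x \<in> B"
    using t open_dom
    by (intro AE_I[where N = "{x\<in>\<Omega>. v x - u x = t}"])
      (auto simp: A_def B_def sets_restrict_space_iff emeasure_restrict_space)
  have A: "grad (\<lambda>x. max (u x) (v x - t)) x = grad v x" "grad (\<lambda>x. min (v x) (u x + t)) x = grad u x"
    if "x \<in> A" for x
    by (rule grad_cong_add_const[where c = "- t"] grad_cong_add_const[where c = t],
        use eventually_nhds_in_open[OF op(1) that] in \<open>force elim!: eventually_mono simp: A_def\<close>)+
  have B: "grad (\<lambda>x. max (u x) (v x - t)) x = grad u x" "grad (\<lambda>x. min (v x) (u x + t)) x = grad v x"
    if "x \<in> B" for x
    using eventually_nhds_in_open[OF op(2) that]
    by (auto intro!: grad_cong_add_const[where c = 0] elim!: eventually_mono simp: B_def)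
  \<comment> \<open>The splitting is along \<open>A\<close> and its complement. The complement is
    \<open>B\<close> up to a null set, so the gradients on \<open>B\<close> determine the second
    integral.\<close>
  have split: "energy f = (\<integral>\<^sup>+x. e g x * indicator A x \<partial>M) + (\<integral>\<^sup>+x. e h x * indicator (space M - A) x \<partial>M)"
    if "\<And>x. x \<in> A \<Longrightarrow> grad f x = grad g x" "\<And>x. x \<in> B \<Longrightarrow> grad f x = grad h x" for f g h
  proof -
    have "energy f = (\<integral>\<^sup>+x. e f x * indicator A x \<partial>M) + (\<integral>\<^sup>+x. e f x * indicator (space M - A) x \<partial>M)"
      unfolding energy_def e_def by (rule nn_integral_split_set) measurable
    also have "(\<integral>\<^sup>+x. e f x * indicator A x \<partial>M) = (\<integral>\<^sup>+x. e g x * indicator A x \<partial>M)"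
      using that(1) by (intro nn_integral_cong) (auto simp: e_def split: split_indicator)
    also have "(\<integral>\<^sup>+x. e f x * indicator (space M - A) x \<partial>M) = (\<integral>\<^sup>+x. e h x * indicator (space M - A) x \<partial>M)"
      by (rule nn_integral_cong_AE, use AB in eventually_elim)
        (use that(2) in \<open>auto simp: e_def split: split_indicator\<close>)
    finally show ?thesis .
  qed
  show ?thesis
    using split[of "\<lambda>x. max (u x) (v x - t)" v u, OF A(1) B(1)] split[of "\<lambda>x. min (v x) (u x + t)" u v, OF A(2) B(2)]
      split[of u u u, OF refl refl] split[of v v v, OF refl refl]
    by (simp only: ac_simps)
qed

text \<open>
  The maximum and minimum of approximants of \<open>u\<close> and \<open>v\<close> are shifted by a generic \<open>t\<close>: the locus where
  the two branches meet is then a null set.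
\<close>
lemma approximants_max_min:
  assumes u: "u \<in> Lp_var \<Omega> p" and v: "v \<in> Lp_var \<Omega> p"
    and a: "mixed_BV_modular \<Omega> p u < a" and b: "mixed_BV_modular \<Omega> p v < b" and d: "0 < d"
  shows "\<exists>f\<in>Lip_Lp. \<exists>g\<in>Lip_Lp.
    modular \<Omega> p (\<lambda>x. f x - max (u x) (v x)) < ennreal d \<and>
    modular \<Omega> p (\<lambda>x. g x - min (u x) (v x)) < ennreal d \<and> energy f + energy g \<le> a + b"
proof -
  note d' = half_tol_pos[OF d]
  \<comment> \<open>The extra halving allows for \<open>b'\<close> below: the modular of the larger
    of the two errors is bounded by the sum of both modulars and must stay under
    \<open>half_tol d\<close>.\<close>
  obtain f where f: "f \<in> Lip_Lp" "modular \<Omega> p (\<lambda>x. f x - u x) < ennreal (half_tol d / 2)" "energy f < a"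
    using mixed_BV_modular_lessD[OF u a, of "half_tol d / 2"] d' by auto
  obtain g where g: "g \<in> Lip_Lp" "modular \<Omega> p (\<lambda>x. g x - v x) < ennreal (half_tol d / 2)" "energy g < b"
    using mixed_BV_modular_lessD[OF v b, of "half_tol d / 2"] d' by auto
  have [measurable]: "u \<in> borel_measurable M" "v \<in> borel_measurable M" "f \<in> borel_measurable M" "g \<in> borel_measurable M"
    using u v f(1) g(1) by (auto simp: Lp_var_iff)
  obtain s where s: "0 < s" "\<And>t. 0 \<le> t \<Longrightarrow> t \<le> s \<Longrightarrow> modular \<Omega> p (\<lambda>x. min t \<bar>g x - f x\<bar>) < ennreal (half_tol d)"
    using modular_truncation_small[of "\<lambda>x. g x - f x", OF _ d'] Lp_var_diff f(1) g(1) by blast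
  have "countable {t. emeasure lebesgue {x\<in>\<Omega>. g x - f x = t} \<noteq> 0}"
    using open_dom by (intro countable_non_null_level_sets) auto
  then have "\<exists>t\<in>{0<..<s}. t \<notin> {t. emeasure lebesgue {x\<in>\<Omega>. g x - f x = t} \<noteq> 0}"
    by (rule open_minus_countable) (use s(1) in auto)
  then obtain t where t: "0 < t" "t < s" "emeasure lebesgue {x\<in>\<Omega>. g x - f x = t} = 0"
    by auto
  define m where "m x = max (f x) (g x - t)" for x
  define n where "n x = min (g x) (f x + t)" for x
  define a' where "a' x = min t \<bar>g x - f x\<bar>" for x
  define b' where "b' x = max \<bar>f x - u x\<bar> \<bar>g x - v x\<bar>" for x
  have [measurable]: "m \<in> borel_measurable M" "n \<in> borel_measurable M" "a' \<in> borel_measurable M" "b' \<in> borel_measurable M"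
    unfolding m_def n_def a'_def b'_def by measurable
  have mn: "m \<in> Lip_Lp" "n \<in> Lip_Lp"
    using f(1) g(1) t(1)
    by (auto intro!: Lip_loc_combine[of f \<Omega> g] Lp_var_dominated[of f g] simp: m_def n_def)
  have a'_small: "modular \<Omega> p a' < ennreal (half_tol d)"
    unfolding a'_def using s(2) t by simp
  have "modular \<Omega> p b' \<le> modular \<Omega> p (\<lambda>x. f x - u x) + modular \<Omega> p (\<lambda>x. g x - v x)"
    by (rule modular_le_max) (auto simp: b'_def)
  also have "\<dots> < ennreal (half_tol d / 2) + ennreal (half_tol d / 2)"
    using f(2) g(2) by (rule add_strict_mono)
  also have "\<dots> = ennreal (half_tol d)"
    using d' by (simp add: ennreal_plus[symmetric] del: ennreal_plus)
  finally have b'_small: "modular \<Omega> p b' < ennreal (half_tol d)" .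
  have "modular \<Omega> p (\<lambda>x. m x - max (u x) (v x)) < ennreal d"
  proof (rule modular_triangle_less[OF _ _ _ a'_small b'_small d], goal_cases)
    case 3
    show ?case using abs_max_shift_diff_le[of t] t(1) by (simp add: m_def a'_def b'_def)
  qed measurable
  moreover have "modular \<Omega> p (\<lambda>x. n x - min (u x) (v x)) < ennreal d"
  proof (rule modular_triangle_less[OF _ _ _ a'_small b'_small d], goal_cases)
    case 3
    show ?case using abs_min_shift_diff_le[of t] t(1) by (simp add: n_def a'_def b'_def)
  qed measurable
  moreover have "energy m + energy n \<le> a + b"
  proof -
    have "energy m + energy n = energy f + energy g"
      unfolding m_def n_def using f(1) g(1) t(3) by (intro energy_max_min_shift) auto
    also have "\<dots> \<le> a + b" by (intro add_mono less_imp_le f(3) g(3))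
    finally show ?thesis .
  qed
  ultimately show ?thesis using mn by blast
qed

text \<open>\<open>approximants_max_min\<close> controls only the sum of the two energies, so both
  sequences are chosen jointly and the limit is taken through superadditivity of the liminf.\<close>

lemma mixed_BV_modular_max_min:
  assumes u: "u \<in> Lp_var \<Omega> p" and v: "v \<in> Lp_var \<Omega> p"
  shows "mixed_BV_modular \<Omega> p (\<lambda>x. max (u x) (v x)) + mixed_BV_modular \<Omega> p (\<lambda>x. min (u x) (v x))
    \<le> mixed_BV_modular \<Omega> p u + mixed_BV_modular \<Omega> p v"
proof (rule ennreal_le_epsilon)
  fix e :: real assume fin: "mixed_BV_modular \<Omega> p u + mixed_BV_modular \<Omega> p v < top" and e: "0 < e"
  define a where "a = mixed_BV_modular \<Omega> p u + ennreal (e / 2)"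
  define b where "b = mixed_BV_modular \<Omega> p v + ennreal (e / 2)"
  have ab: "mixed_BV_modular \<Omega> p u < a" "mixed_BV_modular \<Omega> p v < b"
    using fin e by (auto simp: a_def b_def ennreal_add_eq_top intro!: less_add_ennreal)
  define R where "R k f g \<longleftrightarrow> f \<in> Lip_Lp \<and> g \<in> Lip_Lp \<and>
    modular \<Omega> p (\<lambda>x. f x - max (u x) (v x)) < ennreal (inverse (real (Suc k))) \<and>
    modular \<Omega> p (\<lambda>x. g x - min (u x) (v x)) < ennreal (inverse (real (Suc k))) \<and> energy f + energy g \<le> a + b"
    for k f g
  have "\<exists>f g. R k f g" for k
    using approximants_max_min[OF u v ab, of "inverse (real (Suc k))"] unfolding R_def by fastforce
  then obtain f g where "\<And>k. R k (f k) (g k)" by metis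
  then have fg: "f k \<in> Lip_Lp" "g k \<in> Lip_Lp"
    "modular \<Omega> p (\<lambda>x. f k x - max (u x) (v x)) < ennreal (inverse (real (Suc k)))"
    "modular \<Omega> p (\<lambda>x. g k x - min (u x) (v x)) < ennreal (inverse (real (Suc k)))"
    "energy (f k) + energy (g k) \<le> a + b" for k
    unfolding R_def by blast+
  have "mixed_BV_modular \<Omega> p (\<lambda>x. max (u x) (v x)) + mixed_BV_modular \<Omega> p (\<lambda>x. min (u x) (v x))
      \<le> liminf (\<lambda>k. energy (f k)) + liminf (\<lambda>k. energy (g k))"
    using fg by (intro add_mono mixed_BV_modular_le_liminf Lp_var_max_min u v tendsto_0_of_less_inverse)
  also have "\<dots> \<le> liminf (\<lambda>k. energy (f k) + energy (g k))"
    by (rule liminf_add_le_ennreal)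
  also have "\<dots> \<le> a + b"
    using fg(5) by (intro Liminf_le) auto
  also have "a + b = mixed_BV_modular \<Omega> p u + mixed_BV_modular \<Omega> p v + (ennreal (e / 2) + ennreal (e / 2))"
    by (simp add: a_def b_def ac_simps)
  also have "ennreal (e / 2) + ennreal (e / 2) = ennreal e"
    using e by (simp add: ennreal_plus[symmetric] del: ennreal_plus)
  finally show "mixed_BV_modular \<Omega> p (\<lambda>x. max (u x) (v x)) + mixed_BV_modular \<Omega> p (\<lambda>x. min (u x) (v x))
    \<le> mixed_BV_modular \<Omega> p u + mixed_BV_modular \<Omega> p v + ennreal e" .
qed

text \<open>Pointwise, maximum and minimum only permute the two values.\<close>

lemma modular_max_min:
  assumes [measurable]: "u \<in> borel_measurable M" "v \<in> borel_measurable M"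
  shows "modular \<Omega> p (\<lambda>x. max (u x) (v x)) + modular \<Omega> p (\<lambda>x. min (u x) (v x)) = modular \<Omega> p u + modular \<Omega> p v"
proof -
  let ?e = "\<lambda>f x. ennreal (\<bar>f x\<bar> powr p x)"
  have "modular \<Omega> p (\<lambda>x. max (u x) (v x)) + modular \<Omega> p (\<lambda>x. min (u x) (v x)) =
    (\<integral>\<^sup>+x. ?e (\<lambda>x. max (u x) (v x)) x + ?e (\<lambda>x. min (u x) (v x)) x \<partial>M)"
    unfolding modular_def by (intro nn_integral_add[symmetric]) measurable
  also have "\<dots> = (\<integral>\<^sup>+x. ?e u x + ?e v x \<partial>M)"
    by (intro nn_integral_cong) (simp add: max_def min_def add.commute)
  also have "\<dots> = modular \<Omega> p u + modular \<Omega> p v"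
    unfolding modular_def by (intro nn_integral_add) measurable
  finally show ?thesis .
qed

abbreviation "total_energy u \<equiv> modular \<Omega> p u + mixed_BV_modular \<Omega> p u"

lemma total_energy_max_min:
  assumes "u \<in> Lp_var \<Omega> p" "v \<in> Lp_var \<Omega> p"
  shows "total_energy (\<lambda>x. max (u x) (v x)) + total_energy (\<lambda>x. min (u x) (v x)) \<le> total_energy u + total_energy v"
proof -
  have "total_energy (\<lambda>x. max (u x) (v x)) + total_energy (\<lambda>x. min (u x) (v x)) =
    (modular \<Omega> p (\<lambda>x. max (u x) (v x)) + modular \<Omega> p (\<lambda>x. min (u x) (v x))) +
    (mixed_BV_modular \<Omega> p (\<lambda>x. max (u x) (v x)) + mixed_BV_modular \<Omega> p (\<lambda>x. min (u x) (v x)))"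
    by (simp only: ac_simps)
  also have "\<dots> \<le> (modular \<Omega> p u + modular \<Omega> p v) + (mixed_BV_modular \<Omega> p u + mixed_BV_modular \<Omega> p v)"
    using assms by (intro add_mono[OF eq_refl[OF modular_max_min] mixed_BV_modular_max_min]) (auto simp: Lp_var_iff)
  also have "\<dots> = total_energy u + total_energy v" by (simp only: ac_simps)
  finally show ?thesis .
qed

section \<open>Admissible functions: lattice operations and increasing limits\<close>

lemma admissible_iff:
  "u \<in> admissible \<Omega> p E \<longleftrightarrow> u \<in> Lp_var \<Omega> p \<and> mixed_BV_modular \<Omega> p u < \<infinity> \<and>
    (AE x in M. 0 \<le> u x \<and> u x \<le> 1) \<and>
    (\<exists>U. open U \<and> E \<subseteq> U \<and> U \<subseteq> \<Omega> \<and> (AE x in M. x \<in> U \<longrightarrow> u x = 1))"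
proof -
  have "(AE x in lebesgue_on U. u x = 1) \<longleftrightarrow> (AE x in M. x \<in> U \<longrightarrow> u x = 1)" if "open U" "U \<subseteq> \<Omega>" for U
    using that open_dom by (auto simp: AE_restrict_space_iff elim!: eventually_mono)
  then show ?thesis unfolding admissible_def mixed_BV_def by blast
qed

text \<open>Where \<open>v = 1\<close> the maximum is 1 because \<open>u \<le> 1\<close>, so it
  serves the larger set. The minimum is 1 on the intersection of the two neighbourhoods, which still
  contains \<open>A\<close>. Strong subadditivity makes both relaxed energies finite.\<close>

lemma admissible_max_min:
  assumes u: "u \<in> admissible \<Omega> p A" and v: "v \<in> admissible \<Omega> p B" and "A \<subseteq> B"
  shows "(\<lambda>x. max (u x) (v x)) \<in> admissible \<Omega> p B" "(\<lambda>x. min (u x) (v x)) \<in> admissible \<Omega> p A"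
proof -
  have Lp: "u \<in> Lp_var \<Omega> p" "v \<in> Lp_var \<Omega> p" using u v by (auto simp: admissible_iff)
  have "mixed_BV_modular \<Omega> p (\<lambda>x. max (u x) (v x)) + mixed_BV_modular \<Omega> p (\<lambda>x. min (u x) (v x)) < \<infinity>"
    using u v by (intro le_less_trans[OF mixed_BV_modular_max_min[OF Lp]]) (auto simp: admissible_iff)
  then have fin: "mixed_BV_modular \<Omega> p (\<lambda>x. max (u x) (v x)) < \<infinity>" "mixed_BV_modular \<Omega> p (\<lambda>x. min (u x) (v x)) < \<infinity>"
    by (auto simp: less_top[symmetric] ennreal_add_eq_top)
  have range: "AE x in M. 0 \<le> u x \<and> u x \<le> 1" "AE x in M. 0 \<le> v x \<and> v x \<le> 1"
    using u v by (auto simp: admissible_iff)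
  obtain U where U: "open U" "A \<subseteq> U" "U \<subseteq> \<Omega>" "AE x in M. x \<in> U \<longrightarrow> u x = 1"
    using u unfolding admissible_iff by blast
  obtain V where V: "open V" "B \<subseteq> V" "V \<subseteq> \<Omega>" "AE x in M. x \<in> V \<longrightarrow> v x = 1"
    using v unfolding admissible_iff by blast
  have "AE x in M. x \<in> V \<longrightarrow> max (u x) (v x) = 1"
    using range(1) V(4) by eventually_elim auto
  moreover have "AE x in M. 0 \<le> max (u x) (v x) \<and> max (u x) (v x) \<le> 1"
    using range by eventually_elim auto
  ultimately show "(\<lambda>x. max (u x) (v x)) \<in> admissible \<Omega> p B"
    using V fin Lp_var_max_min[OF Lp] unfolding admissible_iff by blast
  have "AE x in M. x \<in> U \<inter> V \<longrightarrow> min (u x) (v x) = 1"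
    using U(4) V(4) by eventually_elim auto
  moreover have "AE x in M. 0 \<le> min (u x) (v x) \<and> min (u x) (v x) \<le> 1"
    using range by eventually_elim auto
  moreover have "open (U \<inter> V)" "A \<subseteq> U \<inter> V" "U \<inter> V \<subseteq> \<Omega>"
    using U V \<open>A \<subseteq> B\<close> by auto
  ultimately show "(\<lambda>x. min (u x) (v x)) \<in> admissible \<Omega> p A"
    using fin Lp_var_max_min[OF Lp] unfolding admissible_iff by blast
qed

text \<open>The pointwise limit \<open>w\<close> works: Fatou bounds its modular, lower
  semicontinuity its relaxed energy, and \<open>v i \<le> w \<le> 1\<close> forces
  \<open>w = 1\<close> almost everywhere on the union of the neighbourhoods.\<close>

lemma admissible_increasing_limit:
  fixes v :: "nat \<Rightarrow> real^'n \<Rightarrow> real"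
  assumes v: "\<And>i. v i \<in> admissible \<Omega> p (E i)" and mono: "\<And>x. incseq (\<lambda>i. v i x)"
    and bound: "\<And>i. total_energy (v i) \<le> c" and c: "c < \<infinity>"
  shows "\<exists>w\<in>admissible \<Omega> p (\<Union>i. E i). total_energy w \<le> c"
proof -
  have Lp: "v i \<in> Lp_var \<Omega> p" and [measurable]: "v i \<in> borel_measurable M" for i
    using v[of i] by (auto simp: admissible_iff Lp_var_iff)
  \<comment> \<open>Boundedness holds only almost everywhere; on the exceptional null set
    \<open>lim\<close> may be an unspecified value, and every later claim about \<open>w\<close> is
    made almost everywhere.\<close>
  define w where "w x = lim (\<lambda>i. v i x)" for x
  have [measurable]: "w \<in> borel_measurable M" unfolding w_def by measurable
  have lim: "AE x in M. (\<lambda>i. v i x) \<longlonglongrightarrow> w x \<and> (\<forall>i. 0 \<le> v i x \<and> v i x \<le> w x) \<and> w x \<le> 1"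
  proof -
    have "AE x in M. \<forall>i. 0 \<le> v i x \<and> v i x \<le> 1"
      using v by (simp add: AE_all_countable admissible_iff)
    then show ?thesis
    proof eventually_elim
      case (elim x)
      obtain l where l: "(\<lambda>i. v i x) \<longlonglongrightarrow> l" "\<And>i. v i x \<le> l"
        using incseq_convergent[OF mono, of x 1] elim by auto
      then have "w x = l" unfolding w_def by (simp add: limI)
      then show ?case using l elim by (auto intro: LIMSEQ_le_const2)
    qed
  qed
  have powr_lim: "AE x in M. (\<lambda>i. ennreal (\<bar>v i x\<bar> powr p x)) \<longlonglongrightarrow> ennreal (\<bar>w x\<bar> powr p x)"
    using lim AE_exponent by eventually_elim (intro tendsto_ennrealI tendsto_powr' tendsto_rabs; auto)
  have mod_w: "modular \<Omega> p w \<le> liminf (\<lambda>i. modular \<Omega> p (v i))"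
  proof -
    have "modular \<Omega> p w = (\<integral>\<^sup>+x. liminf (\<lambda>i. ennreal (\<bar>v i x\<bar> powr p x)) \<partial>M)"
      unfolding modular_def
      by (rule nn_integral_cong_AE, use powr_lim in eventually_elim) (auto intro!: lim_imp_Liminf[symmetric])
    also have "\<dots> \<le> liminf (\<lambda>i. modular \<Omega> p (v i))"
      unfolding modular_def by (intro nn_integral_liminf) measurable
    finally show ?thesis .
  qed
  also have "\<dots> \<le> c"
  proof (intro Liminf_le always_eventually allI)
    fix i
    show "modular \<Omega> p (v i) \<le> c" using bound[of i] by (rule order_trans[rotated]) simp
  qed simp
  finally have fin: "modular \<Omega> p w < \<infinity>" using c by simp
  then have w: "w \<in> Lp_var \<Omega> p" by (simp add: Lp_var_iff)
  \<comment> \<open>Only now that the modular of \<open>w\<close> is known to be finite can its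
    integrand serve as majorant; \<open>0 \<le> v i \<le> w\<close> gives the domination.\<close>
  have "(\<lambda>i. modular \<Omega> p (\<lambda>x. v i x - w x)) \<longlonglongrightarrow> (\<integral>\<^sup>+x. 0 \<partial>M)"
    unfolding modular_def
  proof (rule nn_integral_dominated_convergence[where w = "\<lambda>x. ennreal (\<bar>w x\<bar> powr p x)"])
    show "AE x in M. ennreal (\<bar>v i x - w x\<bar> powr p x) \<le> ennreal (\<bar>w x\<bar> powr p x)" for i
      using lim AE_exponent
    proof eventually_elim
      case (elim x)
      then have "0 \<le> v i x" "v i x \<le> w x" by auto
      with elim(2) show ?case by (intro ennreal_leI powr_mono2) auto
    qed
    show "AE x in M. (\<lambda>i. ennreal (\<bar>v i x - w x\<bar> powr p x)) \<longlonglongrightarrow> 0"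
      using lim AE_exponent
    proof eventually_elim
      case (elim x)
      then have "(\<lambda>i. \<bar>v i x - w x\<bar>) \<longlonglongrightarrow> 0"
        using LIM_zero tendsto_rabs_zero by blast
      then have "(\<lambda>i. \<bar>v i x - w x\<bar> powr p x) \<longlonglongrightarrow> 0 powr p x"
        using elim by (intro tendsto_powr') auto
      then show ?case using tendsto_ennrealI by fastforce
    qed
  qed (use fin in \<open>auto simp: modular_def\<close>)
  then have "mixed_BV_modular \<Omega> p w \<le> liminf (\<lambda>i. mixed_BV_modular \<Omega> p (v i))"
    by (intro mixed_BV_modular_lsc w Lp) simp
  then have "total_energy w \<le> liminf (\<lambda>i. modular \<Omega> p (v i)) + liminf (\<lambda>i. mixed_BV_modular \<Omega> p (v i))"
    using mod_w by (rule add_mono[rotated])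
  also have "\<dots> \<le> liminf (\<lambda>i. total_energy (v i))" by (rule liminf_add_le_ennreal)
  also have "\<dots> \<le> c" using bound by (intro Liminf_le) auto
  finally have total: "total_energy w \<le> c" .
  have "\<forall>i. \<exists>U. open U \<and> E i \<subseteq> U \<and> U \<subseteq> \<Omega> \<and> (AE x in M. x \<in> U \<longrightarrow> v i x = 1)"
    using v by (simp add: admissible_iff)
  from choice[OF this] obtain U where "\<forall>i. open (U i) \<and> E i \<subseteq> U i \<and> U i \<subseteq> \<Omega> \<and> (AE x in M. x \<in> U i \<longrightarrow> v i x = 1)" ..
  then have U: "open (U i)" "E i \<subseteq> U i" "U i \<subseteq> \<Omega>" "AE x in M. x \<in> U i \<longrightarrow> v i x = 1" for i
    by auto
  have "AE x in M. \<forall>i. x \<in> U i \<longrightarrow> v i x = 1" using U(4) by (simp add: AE_all_countable)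
  then have "AE x in M. x \<in> (\<Union>i. U i) \<longrightarrow> w x = 1"
    using lim
  proof eventually_elim
    case (elim x)
    show ?case
    proof
      assume "x \<in> (\<Union>i. U i)"
      then obtain i where "v i x = 1" using elim by blast
      moreover have "v i x \<le> w x" "w x \<le> 1" using elim by auto
      ultimately show "w x = 1" by simp
    qed
  qed
  moreover have "AE x in M. 0 \<le> w x \<and> w x \<le> 1"
    using lim
  proof eventually_elim
    case (elim x)
    then have "0 \<le> v 0 x" "v 0 x \<le> w x" by auto
    with elim show ?case by auto
  qed
  moreover have "open (\<Union>i. U i)" "(\<Union>i. E i) \<subseteq> (\<Union>i. U i)" "(\<Union>i. U i) \<subseteq> \<Omega>"
    by (intro open_UN ballI UN_mono UN_least subset_UNIV U)+
  moreover have "mixed_BV_modular \<Omega> p w < \<infinity>"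
    using le_less_trans[OF total c] by (auto simp: less_top[symmetric] ennreal_add_eq_top)
  ultimately have "w \<in> admissible \<Omega> p (\<Union>i. E i)"
    using w unfolding admissible_iff by blast
  then show ?thesis using total by blast
qed

section \<open>The capacity: outer regularity and the two continuity properties\<close>

abbreviation "cap \<equiv> mixed_capacity \<Omega> p"

lemma cap_mono: "A \<subseteq> B \<Longrightarrow> cap A \<le> cap B"
  unfolding mixed_capacity_def by (rule INF_superset_mono) (auto simp: admissible_def)

lemma cap_lessE:
  assumes "cap A < c"
  obtains u where "u \<in> admissible \<Omega> p A" "total_energy u < c"
  using assms unfolding mixed_capacity_def INF_less_iff by blast

lemma cap_le: "u \<in> admissible \<Omega> p A \<Longrightarrow> cap A \<le> total_energy u"
  unfolding mixed_capacity_def by (rule INF_lower)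

text \<open>A function admissible for \<open>A\<close> is already admissible for the open
  neighbourhood on which it equals 1.\<close>

lemma cap_outer_less:
  assumes "cap A < c"
  shows "\<exists>U. open U \<and> A \<subseteq> U \<and> U \<subseteq> \<Omega> \<and> cap U < c"
proof -
  obtain u where u: "u \<in> admissible \<Omega> p A" "total_energy u < c"
    using assms by (rule cap_lessE)
  then obtain U where "open U" "A \<subseteq> U" "U \<subseteq> \<Omega>" "AE x in M. x \<in> U \<longrightarrow> u x = 1"
    unfolding admissible_iff by blast
  moreover from this have "u \<in> admissible \<Omega> p U" using u(1) unfolding admissible_iff by blast
  ultimately show ?thesis using cap_le[of u U] u(2) by (blast intro: le_less_trans)
qed

lemma cap_outer_regular: "cap A = (INF U\<in>{U. A \<subseteq> U \<and> U \<subseteq> \<Omega> \<and> open U}. cap U)"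
proof (rule antisym)
  show "cap A \<le> (INF U\<in>{U. A \<subseteq> U \<and> U \<subseteq> \<Omega> \<and> open U}. cap U)"
    by (intro INF_greatest cap_mono) auto
  show "(INF U\<in>{U. A \<subseteq> U \<and> U \<subseteq> \<Omega> \<and> open U}. cap U) \<le> cap A"
  proof (rule dense_ge)
    fix c assume "cap A < c"
    from cap_outer_less[OF this] obtain U where "open U" "A \<subseteq> U" "U \<subseteq> \<Omega>" "cap U < c" by blast
    then show "(INF U\<in>{U. A \<subseteq> U \<and> U \<subseteq> \<Omega> \<and> open U}. cap U) \<le> c"
      by (intro INF_lower2[of U]) auto
  qed
qed

text \<open>An open \<open>U\<close> around the intersection with capacity below \<open>a\<close>
  contains some \<open>K n\<close>, for otherwise the nested compact sets \<open>K n - U\<close>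
  would have a common point. The lower bound is monotonicity.\<close>

lemma cap_decreasing_compacts:
  assumes K: "decseq K" "\<And>i::nat. compact (K i)"
  shows "(\<lambda>i. cap (K i)) \<longlonglongrightarrow> cap (\<Inter>i. K i)"
proof (rule order_tendstoI)
  fix a assume "a < cap (\<Inter>i. K i)"
  then show "\<forall>\<^sub>F i in sequentially. a < cap (K i)"
    by (intro always_eventually allI) (erule less_le_trans, intro cap_mono INT_lower UNIV_I)
next
  fix a assume "cap (\<Inter>i. K i) < a"
  from cap_outer_less[OF this] obtain U where U: "open U" "(\<Inter>i. K i) \<subseteq> U" "cap U < a"
    by blast
  have "\<exists>n. K n \<subseteq> U"
  proof (rule ccontr)
    assume "\<nexists>n. K n \<subseteq> U"
    then have "(\<Inter>n. K n - U) \<noteq> {}"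
      using K U(1) by (intro compact_nest) (auto simp: compact_diff decseq_def)
    then show False using U(2) by blast
  qed
  then obtain n where "K n \<subseteq> U" by blast
  then have "cap (K i) < a" if "n \<le> i" for i
    using decseqD[OF K(1) that] by (intro le_less_trans[OF cap_mono U(3)]) (rule order_trans)
  then show "\<forall>\<^sub>F i in sequentially. cap (K i) < a" by (auto simp: eventually_sequentially)
qed

text \<open>
  Running maxima of almost optimal functions stay almost optimal: by strong subadditivity the \<open>i\<close>-th step
  spends at most \<open>e / 2 ^ (i + 1)\<close>, because the minimum is still admissible for the previous set.
\<close>
lemma cap_increasing_union_le:
  assumes E: "incseq E" and fin: "(SUP i::nat. cap (E i)) < \<infinity>" and e: "0 < e"
  shows "cap (\<Union>i. E i) \<le> (SUP i. cap (E i)) + ennreal e"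
proof -
  have cap_fin: "cap (E i) < \<infinity>" for i
    using fin by (rule le_less_trans[OF SUP_upper, rotated]) simp
  have "\<exists>u. u \<in> admissible \<Omega> p (E i) \<and> total_energy u < cap (E i) + ennreal (e / 2 ^ Suc i)" for i
  proof -
    have "cap (E i) < cap (E i) + ennreal (e / 2 ^ Suc i)"
      using cap_fin[of i] e by (intro less_add_ennreal) auto
    then show ?thesis by (metis cap_lessE)
  qed
  then obtain u where u: "\<And>i. u i \<in> admissible \<Omega> p (E i)"
    "\<And>i. total_energy (u i) < cap (E i) + ennreal (e / 2 ^ Suc i)" by metis
  define v where "v = rec_nat (u 0) (\<lambda>i f x. max (f x) (u (Suc i) x))"
  have v_0: "v 0 = u 0" and v_Suc: "v (Suc i) = (\<lambda>x. max (v i x) (u (Suc i) x))" for i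
    by (simp_all add: v_def)
  \<comment> \<open>The excess is the geometric sum of \<open>e / 2 ^ Suc j\<close> over
    \<open>j \<le> i\<close>, and it stays below \<open>e\<close>.\<close>
  have v: "v i \<in> admissible \<Omega> p (E i) \<and> total_energy (v i) \<le> cap (E i) + ennreal (e * (1 - 1 / 2 ^ Suc i))" for i
  proof (induction i)
    case 0
    have "e / 2 ^ Suc 0 = e * (1 - 1 / 2 ^ Suc 0)" by simp
    then show ?case using u[of 0] v_0 by (auto intro: less_imp_le)
  next
    case (Suc i)
    have sub: "E i \<subseteq> E (Suc i)" using E by (simp add: incseq_SucD)
    note adm = admissible_max_min[OF conjunct1[OF Suc] u(1)[of "Suc i"] sub]
    let ?a = "e * (1 - 1 / 2 ^ Suc i)" and ?b = "e / 2 ^ Suc (Suc i)"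
    have "cap (E i) + total_energy (v (Suc i)) \<le>
        total_energy (\<lambda>x. max (v i x) (u (Suc i) x)) + total_energy (\<lambda>x. min (v i x) (u (Suc i) x))"
      unfolding v_Suc by (subst add.commute) (intro add_mono cap_le adm order_refl)
    also have "\<dots> \<le> total_energy (v i) + total_energy (u (Suc i))"
      using Suc u(1)[of "Suc i"] by (intro total_energy_max_min) (auto simp: admissible_iff)
    also have "\<dots> \<le> (cap (E i) + ennreal ?a) + (cap (E (Suc i)) + ennreal ?b)"
      by (rule add_mono[OF conjunct2[OF Suc] less_imp_le[OF u(2)]])
    also have "\<dots> = cap (E i) + (cap (E (Suc i)) + (ennreal ?a + ennreal ?b))"
      by (simp only: ac_simps)
    also have "ennreal ?a + ennreal ?b = ennreal (?a + ?b)"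
      using e two_realpow_ge_one[of "Suc i"] by (intro ennreal_plus[symmetric]) (auto simp: field_simps)
    also have "?a + ?b = e * (1 - 1 / 2 ^ Suc (Suc i))" by (simp add: field_simps)
    \<comment> \<open>The term \<open>cap (E i)\<close>, a lower bound for the energy of the
      minimum, cancels from both sides; this uses its finiteness.\<close>
    finally have "total_energy (v (Suc i)) \<le> cap (E (Suc i)) + ennreal (e * (1 - 1 / 2 ^ Suc (Suc i)))"
      using cap_fin[of i] by (auto simp: ennreal_add_left_cancel_le)
    then show ?case using adm(1) unfolding v_Suc by blast
  qed
  have "\<exists>w\<in>admissible \<Omega> p (\<Union>i. E i). total_energy w \<le> (SUP i. cap (E i)) + ennreal e"
  proof (rule admissible_increasing_limit)
    show "incseq (\<lambda>i. v i x)" for x by (intro incseq_SucI) (simp add: v_Suc)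
    show "total_energy (v i) \<le> (SUP i. cap (E i)) + ennreal e" for i
    proof -
      have "total_energy (v i) \<le> cap (E i) + ennreal (e * (1 - 1 / 2 ^ Suc i))" using v by blast
      also have "\<dots> \<le> (SUP i. cap (E i)) + ennreal e"
        using e by (intro add_mono SUP_upper ennreal_leI) (auto simp: field_simps)
      finally show ?thesis .
    qed
  qed (use v fin in auto)
  then show ?thesis using cap_le by (blast intro: order_trans)
qed

lemma cap_increasing_union:
  assumes E: "incseq E"
  shows "(\<lambda>i::nat. cap (E i)) \<longlonglongrightarrow> cap (\<Union>i. E i)"
proof -
  have "cap (\<Union>i. E i) = (SUP i. cap (E i))"
  proof (rule antisym)
    show "cap (\<Union>i. E i) \<le> (SUP i. cap (E i))"
    proof (rule ennreal_le_epsilon)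
      fix e :: real assume "(SUP i. cap (E i)) < top" "0 < e"
      then show "cap (\<Union>i. E i) \<le> (SUP i. cap (E i)) + ennreal e"
        by (intro cap_increasing_union_le E) simp_all
    qed
    show "(SUP i. cap (E i)) \<le> cap (\<Union>i. E i)"
      by (intro SUP_least cap_mono) auto
  qed
  moreover have "incseq (\<lambda>i. cap (E i))"
    using E by (auto simp: incseq_def intro!: cap_mono)
  ultimately show ?thesis using LIMSEQ_SUP[of "\<lambda>i. cap (E i)"] by simp
qed

lemma choquet_capacity_cap: "choquet_capacity_on \<Omega> cap"
  unfolding choquet_capacity_on_def
  by (intro conjI allI impI cap_increasing_union cap_decreasing_compacts) (simp_all add: cap_mono)

end

section \<open>Conclusion for exponents with finite essential supremum\<close>

theorem mainTheorem9:
  fixes \<Omega> :: "(real^'n) set" and p :: "real^'n \<Rightarrow> real"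
  assumes "open \<Omega>"
    and "p \<in> borel_measurable (lebesgue_on \<Omega>)"
    and "\<forall>x\<in>\<Omega>. 1 \<le> p x"
    and "esssup (lebesgue_on \<Omega>) (\<lambda>x. ereal (p x)) < \<infinity>"
  shows "choquet_capacity_on \<Omega> (mixed_capacity \<Omega> p) \<and>
    (\<forall>E. E \<in> sets borel \<longrightarrow> E \<subseteq> \<Omega> \<longrightarrow>
      mixed_capacity \<Omega> p E = (SUP K\<in>{K. K \<subseteq> E \<and> compact K}. mixed_capacity \<Omega> p K) \<and>
      mixed_capacity \<Omega> p E = (INF U\<in>{U. E \<subseteq> U \<and> U \<subseteq> \<Omega> \<and> open U}. mixed_capacity \<Omega> p U))"
proof -
  let ?m = "esssup (lebesgue_on \<Omega>) (\<lambda>x. ereal (p x))"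
  \<comment> \<open>Only an upper bound is extracted, since the essential supremum is
    \<open>-\<infinity>\<close> when the domain is empty.\<close>
  obtain P where P: "?m \<le> ereal P"
    using assms(4) by (cases ?m) auto
  have "AE x in lebesgue_on \<Omega>. p x \<le> P"
    using esssup_AE[of "\<lambda>x. ereal (p x)" "lebesgue_on \<Omega>"]
  proof eventually_elim
    case (elim x)
    then show ?case using order_trans[OF elim P] by simp
  qed
  then interpret bounded_exponent \<Omega> p P
    using assms by unfold_locales auto
  show ?thesis
    by (intro conjI allI impI choquet_capacity_cap cap_outer_regular
        choquet_capacitability[OF choquet_capacity_cap open_dom])
qed

end
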